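(* Let $r>0$ and let $\mathcal X$ be the sticky Brownian motion on $\mathsf E$ with parameters $b,c$. The mean exit time $$v(\mathsf x)=\mathbb E\big[T^\star\mid\mathcal X(0)=\mathsf x\big],\qquad T^\star=\inf\{t>0:|\mathcal X(t)|=r\},$$ satisfies the Poisson problem on the ball $B_r(0)$; that is: $v$ belongs to the domain $D(A_{\mathcal X})$, $\frac12A_{\mathcal X}v(\mathsf x)=-1$ for $\mathsf x\in B_r(0)$, and $v_j(r)=0$ for $j=1,\dots,n$.
   Context: Star graph: take $n$ copies $\mathsf e_j=[0,\infty)$, $j=1,\dots,n$, denote points by $(j,x)$ ($j$ the ray, $x\ge0$ the distance from the origin), and identify all the points $(j,0)$ to a single vertex $0$; the quotient is $\mathsf E$, with distance $d((j,x),(k,y))=|x-y|$ if $j=k$ and $x+y$ if $j\ne k$. For $f$ on $\mathsf E$ write $f_j(x)=f(j,x)$ and $f_j'(0)=\lim_{r\downarrow0}\frac{\partial}{\partial r}f(j,r)$. $C_0(\mathsf E)$ is the space of continuous functions vanishing at infinity, and $C_0^2(\mathsf E)$ the space of $f\in C_0(\mathsf E)$ twice continuously differentiable on each open ray whose second derivative extends to a function in $C_0(\mathsf E)$; $f''(0)=\lim_{x\to0}f_j''(x)$ (finite, independent of $j$). Weights $p_1,\dots,p_n\in[0,1]$ with $\sum_kp_k=1$ and constants $b,c>0$ with $b+c=1$ are fixed. Define $A_{\mathcal X}f(\mathsf x)=f_j''(x)$ for $\mathsf x=(j,x)$, with $$D(A_{\mathcal X})=\Big\{f\in C_0^2(\mathsf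 E):\tfrac12 c f''(0)=b\sum_{k=1}^np_kf_k'(0)\Big\}.$$ The sticky Brownian motion $\mathcal X$ with parameters $b,c$ is the continuous strong Markov process on $\mathsf E$ whose generator on $C_0(\mathsf E)$ is $\frac12A_{\mathcal X}$ with domain $D(A_{\mathcal X})$; its radial component absorbed at $0$ is a Brownian motion on $[0,\infty)$ absorbed at $0$. For a function defined only on the closed ball of radius $r$, membership in $D(A_{\mathcal X})$ means: it is continuous, twice continuously differentiable on each open segment $\{(j,x):0<x<r\}$, its second derivative extends continuously to the vertex (with a common limit $f''(0)$ along all rays), and the vertex condition $\frac12 c f''(0)=b\sum_kp_kf_k'(0)$ holds. $B_r(0)=\{(j,x)\in\mathsf E:x<r\}$, and $|\cdot|$ denotes the radial component (distance from $0$). *)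

theory Defs
  imports "HOL-Probability.Probability"
begin

section \<open>The star graph\<close>

text \<open>The rays are indexed by a finite type; the relation is a partial equivalence, so only
  pairs with nonnegative second component represent points.\<close>

definition star_rel :: "'n \<times> real \<Rightarrow> 'n \<times> real \<Rightarrow> bool" where
  "star_rel u v \<longleftrightarrow> 0 \<le> snd u \<and> 0 \<le> snd v \<and> (u = v \<or> snd u = 0 \<and> snd v = 0)"

lemma part_equivp_star_rel: "part_equivp star_rel"
proof (rule part_equivpI)
  show "\<exists>u :: 'a \<times> real. star_rel u u"
    by (rule exI[of _ "(undefined, 0)"]) (simp add: star_rel_def)
qed (auto intro!: sympI transpI simp: star_rel_def)

quotient_type 'n star = "'n \<times> real" / partial: star_rel
  by (rule part_equivp_star_rel)

text \<open>Negative arguments of \<open>pt\<close> are sent to the vertex.\<close>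

lift_definition pt :: "'n \<Rightarrow> real \<Rightarrow> 'n star" is "\<lambda>j x. (j, max 0 x)"
  by (simp add: star_rel_def)

lift_definition radial :: "'n star \<Rightarrow> real" is snd
  by (auto simp: star_rel_def)

lemma pt_radial_cases:
  obtains j x where "0 \<le> x" "u = pt j x" "radial u = x"
proof -
  have "\<exists>j x. 0 \<le> x \<and> u = pt j x \<and> radial u = x"
    by transfer (auto simp: star_rel_def)
  then show ?thesis using that by blast
qed

lemma radial_pt [simp]: "radial (pt j x) = max 0 x"
  by transfer simp

lemma radial_nonneg [simp]: "0 \<le> radial u"
  by transfer (auto simp: star_rel_def)

lemma pt_0_eq: "pt j 0 = pt k 0"
  by transfer (simp add: star_rel_def)

lemma pt_eq_iff:
  assumes "0 \<le> x" "0 \<le> y"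
  shows "pt j x = pt k y \<longleftrightarrow> x = y \<and> (j = k \<or> x = 0)"
  using assms by transfer (auto simp: star_rel_def)

instantiation star :: (type) metric_space
begin

lift_definition dist_star :: "'a star \<Rightarrow> 'a star \<Rightarrow> real" is
  "\<lambda>u v. if fst u = fst v then \<bar>snd u - snd v\<bar> else snd u + snd v"
  by (auto simp: star_rel_def)

definition uniformity_star :: "('a star \<times> 'a star) filter" where
  "uniformity_star = (INF e\<in>{0<..}. principal {(x, y). dist x y < e})"

definition open_star :: "'a star set \<Rightarrow> bool" where
  "open_star U \<longleftrightarrow> (\<forall>x\<in>U. eventually (\<lambda>(x', y). x' = x \<longrightarrow> y \<in> U) uniformity)"

instance
proof
  fix x y z :: "'a star"
  show "dist x y = 0 \<longleftrightarrow> x = y"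
    by transfer (auto simp: star_rel_def prod_eq_iff)
  show "dist x y \<le> dist x z + dist y z"
    by transfer (auto simp: star_rel_def)
qed (rule uniformity_star_def open_star_def)+

end

lemma dist_pt:
  assumes "0 \<le> x" "0 \<le> y"
  shows "dist (pt j x) (pt k y) = (if j = k then \<bar>x - y\<bar> else x + y)"
  using assms by transfer simp

lemma dist_vertex: "dist (pt k 0) u = radial u"
  by transfer (auto simp: star_rel_def)

section \<open>Functions on the star graph\<close>

definition on_ray :: "('n star \<Rightarrow> real) \<Rightarrow> 'n \<Rightarrow> real \<Rightarrow> real" where
  "on_ray f j x = f (pt j x)"

definition on_ray' :: "('n star \<Rightarrow> real) \<Rightarrow> 'n \<Rightarrow> real \<Rightarrow> real" where
  "on_ray' f j = deriv (on_ray f j)"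

definition on_ray'' :: "('n star \<Rightarrow> real) \<Rightarrow> 'n \<Rightarrow> real \<Rightarrow> real" where
  "on_ray'' f j = deriv (deriv (on_ray f j))"

definition C0 :: "('n star \<Rightarrow> real) set" where
  "C0 = {f. continuous_on UNIV f \<and> (f \<longlongrightarrow> 0) (filtercomap radial at_top)}"

text \<open>Two continuous derivatives on the part \<open>0 < x < R\<close> of every ray; \<open>R = \<infinity>\<close> gives the
  whole open rays.\<close>

definition C2_on_rays :: "ereal \<Rightarrow> ('n star \<Rightarrow> real) \<Rightarrow> bool" where
  "C2_on_rays R f \<longleftrightarrow> (\<forall>j.
     (\<forall>x. 0 < x \<and> ereal x < R \<longrightarrow>
        on_ray f j field_differentiable at x \<and> on_ray' f j field_differentiable at x) \<and>
     continuous_on {x. 0 < x \<and> ereal x < R} (on_ray'' f j))"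

definition C0_2 :: "('n star \<Rightarrow> real) set" where
  "C0_2 = {f \<in> C0. C2_on_rays \<infinity> f \<and> (\<exists>g\<in>C0. \<forall>j. \<forall>x>0. g (pt j x) = on_ray'' f j x)}"

text \<open>\<open>l\<close> is \<open>f''(0)\<close> and \<open>d k\<close> is \<open>f\<^sub>k'(0)\<close>; both are one-sided limits along the rays.\<close>

definition vertex_condition :: "('n::finite \<Rightarrow> real) \<Rightarrow> real \<Rightarrow> real \<Rightarrow> ('n star \<Rightarrow> real) \<Rightarrow> bool" where
  "vertex_condition p b c f \<longleftrightarrow> (\<exists>l d.
     (\<forall>j. (on_ray'' f j \<longlongrightarrow> l) (at_right 0)) \<and>
     (\<forall>k. (on_ray' f k \<longlongrightarrow> d k) (at_right 0)) \<and>
     1 / 2 * c * l = b * (\<Sum>k\<in>UNIV. p k * d k))"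

definition A_dom :: "('n::finite \<Rightarrow> real) \<Rightarrow> real \<Rightarrow> real \<Rightarrow> ('n star \<Rightarrow> real) set" where
  "A_dom p b c = {f \<in> C0_2. vertex_condition p b c f}"

text \<open>Membership in the domain for functions of which only the values on the closed ball
  of radius \<open>r\<close> matter. That \<open>f''\<close> has a common finite limit at the vertex is part of
  \<open>vertex_condition\<close>.\<close>

definition A_dom_ball ::
    "('n::finite \<Rightarrow> real) \<Rightarrow> real \<Rightarrow> real \<Rightarrow> real \<Rightarrow> ('n star \<Rightarrow> real) set" where
  "A_dom_ball p b c r =
     {f. continuous_on {u. radial u \<le> r} f \<and> C2_on_rays (ereal r) f \<and> vertex_condition p b c f}"

text \<open>The index of the ray is unique except at the vertex, where \<open>A_op\<close> does not use it.\<close>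

definition ray_of :: "'n star \<Rightarrow> 'n" where
  "ray_of u = (SOME j. u = pt j (radial u))"

definition A_op :: "('n star \<Rightarrow> real) \<Rightarrow> 'n star \<Rightarrow> real" where
  "A_op f u = (if radial u = 0 then (THE l. \<forall>j. (on_ray'' f j \<longlongrightarrow> l) (at_right 0))
               else on_ray'' f (ray_of u) (radial u))"

lemma ray_of_pt: "0 < x \<Longrightarrow> ray_of (pt j x) = j"
  by (auto simp: ray_of_def pt_eq_iff)

lemma A_op_pt: "0 < x \<Longrightarrow> A_op f (pt j x) = on_ray'' f j x"
  by (simp add: A_op_def ray_of_pt)

lemma A_op_vertex:
  assumes "\<And>j. (on_ray'' f j \<longlongrightarrow> l) (at_right 0)"
  shows "A_op f (pt k 0) = l"
proof -
  have "(THE l. \<forall>j. (on_ray'' f j \<longlongrightarrow> l) (at_right 0)) = l"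
    using assms by (intro the_equality) (auto intro: tendsto_unique[OF trivial_limit_at_right_real])
  then show ?thesis by (simp add: A_op_def)
qed

section \<open>Continuous strong Markov processes and their generators\<close>

text \<open>Real time parameters are only considered on \<open>[0,\<infinity>)\<close>. The filtration is indexed by
  \<open>[0,\<infinity>]\<close>, so that stopping times may be infinite.\<close>

definition natural_filtration ::
    "'w measure \<Rightarrow> (real \<Rightarrow> 'w \<Rightarrow> 'e::topological_space) \<Rightarrow> ennreal \<Rightarrow> 'w measure" where
  "natural_filtration M X t = sigma (space M)
     {X s -` B \<inter> space M | s B. 0 \<le> s \<and> ennreal s \<le> t \<and> B \<in> sets borel}"

lemma filtration_natural: "filtration (space M) (natural_filtration M X)"
proof
  show "space (natural_filtration M X i) = space M" for i
    unfolding natural_filtration_def by (rule space_measure_of) auto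
  fix i j :: ennreal assume "i \<le> j"
  show "sets (natural_filtration M X i) \<subseteq> sets (natural_filtration M X j)"
    unfolding natural_filtration_def
    using \<open>i \<le> j\<close> by (subst (1 2) sets_measure_of) (auto intro!: sigma_sets_mono' intro: order_trans)
qed

definition transition_semigroup ::
    "('e \<Rightarrow> 'w measure) \<Rightarrow> (real \<Rightarrow> 'w \<Rightarrow> 'e) \<Rightarrow> real \<Rightarrow> ('e \<Rightarrow> real) \<Rightarrow> 'e \<Rightarrow> real" where
  "transition_semigroup P X t f u = (\<integral>\<omega>. f (X t \<omega>) \<partial>P u)"

text \<open>\<open>M\<close> only provides the common sample space and \<open>\<sigma>\<close>-algebra of the measures \<open>P u\<close>, the law
  of the process started at \<open>u\<close>. The last clause is the strong Markov property
  \<open>E\<^sub>u[f(X\<^bsub>\<tau>+t\<^esub>); \<Lambda> \<inter> {\<tau> < \<infinity>}] = E\<^sub>u[E\<^bsub>X\<^bsub>\<tau>\<^esub>\<^esub>[f(X\<^sub>t)]; \<Lambda> \<inter> {\<tau> < \<infinity>}]\<close> for \<open>\<Lambda>\<close> in the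
  \<open>\<sigma>\<close>-algebra of the \<open>\<tau>\<close>-past; constant \<open>\<tau>\<close> give the Markov property.\<close>

definition continuous_strong_markov ::
    "'w measure \<Rightarrow> ('e::topological_space \<Rightarrow> 'w measure) \<Rightarrow> (real \<Rightarrow> 'w \<Rightarrow> 'e) \<Rightarrow> bool" where
  "continuous_strong_markov M P X \<longleftrightarrow>
     (\<forall>u. prob_space (P u) \<and> sets (P u) = sets M) \<and>
     (\<forall>t\<ge>0. X t \<in> borel_measurable M) \<and>
     (\<forall>t\<ge>0. (\<lambda>u. distr (P u) borel (X t)) \<in> borel \<rightarrow>\<^sub>M prob_algebra borel) \<and>
     (\<forall>\<omega>\<in>space M. continuous_on {0..} (\<lambda>t. X t \<omega>)) \<and>
     (\<forall>u. AE \<omega> in P u. X 0 \<omega> = u) \<and>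
     (\<forall>\<tau> \<Lambda> t f u.
        stopping_time (natural_filtration M X) \<tau> \<longrightarrow>
        \<Lambda> \<in> sets (filtration.pre_sigma (space M) (natural_filtration M X) \<tau>) \<longrightarrow>
        0 \<le> t \<longrightarrow> f \<in> borel_measurable borel \<longrightarrow> bounded (range f) \<longrightarrow>
        (LINT \<omega>:\<Lambda> \<inter> {\<omega>. \<tau> \<omega> < \<infinity>}|P u. f (X (enn2real (\<tau> \<omega>) + t) \<omega>)) =
        (LINT \<omega>:\<Lambda> \<inter> {\<omega>. \<tau> \<omega> < \<infinity>}|P u. transition_semigroup P X t f (X (enn2real (\<tau> \<omega>)) \<omega>)))"

definition C0_semigroup :: "(real \<Rightarrow> ('n star \<Rightarrow> real) \<Rightarrow> 'n star \<Rightarrow> real) \<Rightarrow> bool" where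
  "C0_semigroup T \<longleftrightarrow>
     (\<forall>t\<ge>0. \<forall>f\<in>C0. T t f \<in> C0) \<and>
     (\<forall>f\<in>C0. uniform_limit UNIV (\<lambda>t. T t f) f (at_right 0))"

text \<open>The generator as a graph; convergence is in the supremum norm.\<close>

definition generator ::
    "(real \<Rightarrow> ('n star \<Rightarrow> real) \<Rightarrow> 'n star \<Rightarrow> real) \<Rightarrow> (('n star \<Rightarrow> real) \<times> ('n star \<Rightarrow> real)) set" where
  "generator T = {(f, g). f \<in> C0 \<and> g \<in> C0 \<and>
     uniform_limit UNIV (\<lambda>t u. (T t f u - f u) / t) g (at_right 0)}"

definition sticky_brownian_motion ::
    "('n::finite \<Rightarrow> real) \<Rightarrow> real \<Rightarrow> real \<Rightarrow>
     'w measure \<Rightarrow> ('n star \<Rightarrow> 'w measure) \<Rightarrow> (real \<Rightarrow> 'w \<Rightarrow> 'n star) \<Rightarrow> bool" where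
  "sticky_brownian_motion p b c M P X \<longleftrightarrow>
     continuous_strong_markov M P X \<and>
     C0_semigroup (transition_semigroup P X) \<and>
     generator (transition_semigroup P X) = {(f, \<lambda>u. 1 / 2 * A_op f u) | f. f \<in> A_dom p b c}"

section \<open>Exit times\<close>

text \<open>The infimum of the empty set is \<open>\<infinity>\<close> in \<^typ>\<open>ennreal\<close>.\<close>

definition exit_time :: "(real \<Rightarrow> 'w \<Rightarrow> 'n star) \<Rightarrow> real \<Rightarrow> 'w \<Rightarrow> ennreal" where
  "exit_time X r \<omega> = Inf {ennreal t | t. 0 < t \<and> radial (X t \<omega>) = r}"

definition mean_exit_time ::
    "('n star \<Rightarrow> 'w measure) \<Rightarrow> (real \<Rightarrow> 'w \<Rightarrow> 'n star) \<Rightarrow> real \<Rightarrow> 'n star \<Rightarrow> ennreal" where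
  "mean_exit_time P X r u = (\<integral>\<^sup>+ \<omega>. exit_time X r \<omega> \<partial>P u)"

end

theory Submission
  imports Defs "HOL-Real_Asymp.Real_Asymp"
begin

text \<open>
  The Poisson problem has an explicit radial solution. On every ray \<open>v'' = -2\<close> and \<open>v r = 0\<close> leave
  one free constant, and the vertex condition fixes it: \<open>v = \<phi>(|x|)\<close> with
  \<open>\<phi> x = r\<^sup>2 - x\<^sup>2 + (c / b) (r - x)\<close>. So the theorem amounts to the identity
  \<open>E\<^sub>u[T\<^sup>\<star>] = \<phi>(|u|)\<close> on the closed ball (\<open>mean_exit_time_sticky\<close>), after which
  regularity, the vertex condition, the equation and the boundary values are read off from the
  polynomial.

  The identity comes from Dynkin's formula \<open>E[f(X\<^sub>\<theta>)] - E[f(X\<^sub>a)] = E[\<integral>\<^sub>a\<^sup>\<theta> Lf(X\<^sub>s) ds]\<close> at hitting times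
  \<open>\<theta>\<close> of the sphere (\<open>dynkin_first_hit\<close>). It follows from the description of the process by its
  generator: the Markov property gives \<open>d/dq E[f(X\<^sub>q); L] = E[Lf(X\<^sub>q); L]\<close> for events \<open>L\<close> of the past
  (\<open>expectation_derivative\<close>), so that \<open>f(X\<^sub>q) - \<integral> Lf(X\<^sub>s) ds\<close> is a bounded continuous martingale,
  and optional stopping on finer and finer grids (\<open>optional_stopping_continuous\<close>) passes to \<open>\<theta>\<close>.

  For \<open>|u| < r\<close> the formula is applied to \<open>\<phi>\<close>, continued beyond radius \<open>r\<close> to a function in the domain of the
  generator; there \<open>L\<phi> = -1\<close> up to time \<open>\<theta>\<close>, and the cap on \<open>\<theta>\<close> is removed by
  monotone and dominated convergence (\<open>mean_exit_time_from_inside\<close>).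

  For \<open>|u| = r\<close> the boundary value \<open>0\<close> is a separate matter, because \<open>T\<^sup>\<star>\<close> only counts strictly positive
  times: the process has to return to the sphere immediately. A path that does not do so runs for some
  time strictly inside or strictly outside. Each side is excluded by a function \<open>f\<close> in the domain that is
  minimal on the sphere and satisfies \<open>Lf < 0\<close> on that side (\<open>no_one_sided_escape\<close>): the
  continued \<open>\<phi>\<close> for the inside, and \<open>-x\<^sup>3 exp(-6 x / r)\<close> for the outside.
\<close>

section \<open>Bounded processes with continuous paths\<close>

text \<open>The path \<open>q \<mapsto> Y q \<omega>\<close> is the pointwise limit of the step functions that sample it on the grid of
  mesh \<open>1 / (n + 1)\<close>, and a process with countably many sampling times is jointly measurable.
  This is what allows time integrals and expectations to be exchanged.\<close>

lemma borel_measurable_continuous_paths: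
  fixes Y :: "real \<Rightarrow> 'w \<Rightarrow> real"
  assumes meas: "\<And>q. Y q \<in> borel_measurable N"
    and cont: "\<And>\<omega>. \<omega> \<in> space N \<Longrightarrow> continuous_on UNIV (\<lambda>q. Y q \<omega>)"
  shows "(\<lambda>z. Y (fst z) (snd z)) \<in> borel_measurable (lborel \<Otimes>\<^sub>M N)"
proof (rule borel_measurable_LIMSEQ_real)
  let ?d = "\<lambda>n q. of_int \<lfloor>real (Suc n) * q\<rfloor> / real (Suc n)"
  show "(\<lambda>z. Y (?d n (fst z)) (snd z)) \<in> borel_measurable (lborel \<Otimes>\<^sub>M N)" for n
  proof -
    have "(\<lambda>z. (\<lambda>i z. Y (of_int i / real (Suc n)) (snd z)) \<lfloor>real (Suc n) * fst z\<rfloor> z)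
        \<in> borel_measurable (lborel \<Otimes>\<^sub>M N)"
    proof (rule measurable_compose_countable'[where I = UNIV
          and f = "\<lambda>i z. Y (of_int i / real (Suc n)) (snd z)" and g = "\<lambda>z. \<lfloor>real (Suc n) * fst z\<rfloor>"])
      show "(\<lambda>z. Y (of_int i / real (Suc n)) (snd z)) \<in> borel_measurable (lborel \<Otimes>\<^sub>M N)" for i
        by (rule measurable_compose[OF measurable_snd meas])
      show "(\<lambda>z. \<lfloor>real (Suc n) * fst z\<rfloor>) \<in> lborel \<Otimes>\<^sub>M N \<rightarrow>\<^sub>M count_space UNIV"
        by measurable
    qed simp
    then show ?thesis by simp
  qed
  fix z :: "real \<times> 'w" assume "z \<in> space (lborel \<Otimes>\<^sub>M N)"
  then have "snd z \<in> space N" by (auto simp: space_pair_measure)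
  then have "isCont (\<lambda>q. Y q (snd z)) (fst z)"
    using cont by (simp add: continuous_on_eq_continuous_at)
  moreover have "(\<lambda>n. ?d n (fst z)) \<longlonglongrightarrow> fst z"
  proof (rule real_tendsto_sandwich[where f = "\<lambda>n. fst z - 1 / real (Suc n)" and h = "\<lambda>n. fst z"])
    show "(\<lambda>n. fst z - 1 / real (Suc n)) \<longlonglongrightarrow> fst z"
      using tendsto_diff[OF tendsto_const LIMSEQ_Suc[OF lim_1_over_n]] by simp
    show "\<forall>\<^sub>F n in sequentially. fst z - 1 / real (Suc n) \<le> ?d n (fst z)"
    proof (rule always_eventually, rule allI)
      fix n
      have "real (Suc n) * fst z - 1 \<le> of_int \<lfloor>real (Suc n) * fst z\<rfloor>" by linarith
      then have "(real (Suc n) * fst z - 1) / real (Suc n) \<le> ?d n (fst z)"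
        by (intro divide_right_mono) auto
      then show "fst z - 1 / real (Suc n) \<le> ?d n (fst z)"
        by (simp add: diff_divide_distrib del: of_nat_Suc)
    qed
    show "\<forall>\<^sub>F n in sequentially. ?d n (fst z) \<le> fst z"
      by (rule always_eventually) (auto simp: divide_le_eq mult.commute simp del: of_nat_Suc)
  qed simp
  ultimately show "(\<lambda>n. Y (?d n (fst z)) (snd z)) \<longlonglongrightarrow> Y (fst z) (snd z)"
    by (rule isCont_tendsto_compose)
qed

lemma (in finite_measure) integrable_bounded:
  fixes Y :: "'a \<Rightarrow> real"
  assumes "Y \<in> borel_measurable M" "\<And>\<omega>. \<omega> \<in> space M \<Longrightarrow> \<bar>Y \<omega>\<bar> \<le> C"
  shows "integrable M Y"
  using assms by (intro integrable_const_bound[where B = C]) auto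

text \<open>The fundamental theorem of calculus under the expectation: if \<open>E[Z q; L]\<close> is the time derivative of
  \<open>E[Y q; L]\<close>, integrating it over \<open>{s..t}\<close> and applying Fubini gives the expected increment
  of \<open>Y\<close> on \<open>L\<close>.\<close>

lemma expectation_increment:
  fixes Y Z :: "real \<Rightarrow> 'w \<Rightarrow> real"
  assumes N: "prob_space N"
    and Z: "\<And>q. Z q \<in> borel_measurable N"
    and Zcont: "\<And>\<omega>. \<omega> \<in> space N \<Longrightarrow> continuous_on UNIV (\<lambda>q. Z q \<omega>)"
    and Zbd: "\<And>q \<omega>. \<bar>Z q \<omega>\<bar> \<le> C"
    and L[measurable]: "L \<in> sets N"
    and st: "s \<le> t"
    and deriv: "\<And>q. s \<le> q \<Longrightarrow> q \<le> t \<Longrightarrow>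
      ((\<lambda>q. \<integral>\<omega>. Y q \<omega> * indicator L \<omega> \<partial>N) has_real_derivative (\<integral>\<omega>. Z q \<omega> * indicator L \<omega> \<partial>N))
        (at q within {s..t})"
  shows "(\<integral>\<omega>. integral {s..t} (\<lambda>q. Z q \<omega>) * indicator L \<omega> \<partial>N) =
      (\<integral>\<omega>. Y t \<omega> * indicator L \<omega> \<partial>N) - (\<integral>\<omega>. Y s \<omega> * indicator L \<omega> \<partial>N)" (is ?eq)
    and "(\<lambda>\<omega>. integral {s..t} (\<lambda>q. Z q \<omega>)) \<in> borel_measurable N" (is ?meas)
proof -
  interpret N: prob_space N by fact
  interpret P: pair_sigma_finite lborel N ..
  have jm[measurable]: "(\<lambda>z. Z (fst z) (snd z)) \<in> borel_measurable (lborel \<Otimes>\<^sub>M N)"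
    by (rule borel_measurable_continuous_paths[OF Z Zcont])
  have C: "0 \<le> C" using Zbd[of undefined undefined] by linarith
  have path: "integral {s..t} (\<lambda>q. Z q \<omega>) = (\<integral>q. indicator {s..t} q * Z q \<omega> \<partial>lborel)"
    if "\<omega> \<in> space N" for \<omega>
  proof -
    have "set_integrable lborel {s..t} (\<lambda>q. Z q \<omega>)"
      by (rule borel_integrable_atLeastAtMost')
        (rule continuous_on_subset[OF Zcont[OF that]], simp)
    from set_borel_integral_eq_integral(2)[OF this] show ?thesis
      by (simp add: set_lebesgue_integral_def)
  qed
  have m: "(\<lambda>(\<omega>, q). indicator {s..t} q * Z q \<omega>) \<in> borel_measurable (N \<Otimes>\<^sub>M lborel)"
  proof -
    have "(\<lambda>z. Z (snd z) (fst z)) \<in> borel_measurable (N \<Otimes>\<^sub>M lborel)"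
      using measurable_compose[OF measurable_pair_swap' jm] by (simp add: case_prod_beta)
    then show ?thesis by (simp add: case_prod_beta)
  qed
  show ?meas
    by (subst measurable_cong[OF path]) (auto intro!: lborel.borel_measurable_lebesgue_integral m)
  let ?f = "\<lambda>q \<omega>. indicator {s..t} q * Z q \<omega> * indicator L \<omega>"
  have int: "integrable (lborel \<Otimes>\<^sub>M N) (\<lambda>(q, \<omega>). ?f q \<omega>)"
  proof (rule integrableI_bounded_set[where A = "{s..t} \<times> space N" and B = C])
    show "emeasure (lborel \<Otimes>\<^sub>M N) ({s..t} \<times> space N) < \<infinity>"
      using st by (subst N.emeasure_pair_measure_Times) (auto simp: N.emeasure_space_1)
    show "(\<lambda>(q, \<omega>). ?f q \<omega>) \<in> borel_measurable (lborel \<Otimes>\<^sub>M N)"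
      by (simp add: case_prod_beta)
    show "AE z in lborel \<Otimes>\<^sub>M N. z \<notin> {s..t} \<times> space N \<longrightarrow> (case z of (q, \<omega>) \<Rightarrow> ?f q \<omega>) = 0"
      by (rule AE_I2) (auto simp: space_pair_measure indicator_def)
  qed (use Zbd C in \<open>auto split: split_indicator\<close>)
  have "(\<integral>\<omega>. integral {s..t} (\<lambda>q. Z q \<omega>) * indicator L \<omega> \<partial>N) = (\<integral>\<omega>. (\<integral>q. ?f q \<omega> \<partial>lborel) \<partial>N)"
    by (rule Bochner_Integration.integral_cong) (simp_all add: path)
  also have "\<dots> = (\<integral>q. (\<integral>\<omega>. ?f q \<omega> \<partial>N) \<partial>lborel)"
    by (rule P.Fubini_integral[OF int])
  also have "\<dots> = (\<integral>q. indicator {s..t} q *\<^sub>R (\<integral>\<omega>. Z q \<omega> * indicator L \<omega> \<partial>N) \<partial>lborel)"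
    by (simp add: mult.assoc)
  also have "\<dots> = (\<integral>\<omega>. Y t \<omega> * indicator L \<omega> \<partial>N) - (\<integral>\<omega>. Y s \<omega> * indicator L \<omega> \<partial>N)"
  proof (rule integral_FTC_atLeastAtMost[OF st])
    show "((\<lambda>q. \<integral>\<omega>. Y q \<omega> * indicator L \<omega> \<partial>N) has_vector_derivative
        (\<integral>\<omega>. Z q \<omega> * indicator L \<omega> \<partial>N)) (at q within {s..t})" if "s \<le> q" "q \<le> t" for q
      using deriv[OF that] by (simp add: has_real_derivative_iff_has_vector_derivative)
    show "continuous_on {s..t} (\<lambda>q. \<integral>\<omega>. Z q \<omega> * indicator L \<omega> \<partial>N)"
      unfolding continuous_on_sequentially
    proof (intro allI ballI impI)
      fix x q assume x: "q \<in> {s..t}" "(\<forall>n. x n \<in> {s..t}) \<and> x \<longlonglongrightarrow> q"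
      show "((\<lambda>q. \<integral>\<omega>. Z q \<omega> * indicator L \<omega> \<partial>N) \<circ> x) \<longlonglongrightarrow> (\<integral>\<omega>. Z q \<omega> * indicator L \<omega> \<partial>N)"
        unfolding o_def
      proof (rule integral_dominated_convergence[where w = "\<lambda>_. C"])
        show "AE \<omega> in N. (\<lambda>n. Z (x n) \<omega> * indicator L \<omega>) \<longlonglongrightarrow> Z q \<omega> * indicator L \<omega>"
        proof (rule AE_I2)
          fix \<omega> assume "\<omega> \<in> space N"
          then have "isCont (\<lambda>q. Z q \<omega>) q"
            using Zcont by (simp add: continuous_on_eq_continuous_at)
          then have "(\<lambda>n. Z (x n) \<omega>) \<longlonglongrightarrow> Z q \<omega>"
            using x by (auto intro: isCont_tendsto_compose)
          then show "(\<lambda>n. Z (x n) \<omega> * indicator L \<omega>) \<longlonglongrightarrow> Z q \<omega> * indicator L \<omega>"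
            by (intro tendsto_intros)
        qed
      qed (use Zbd C Z in \<open>auto split: split_indicator\<close>)
    qed
  qed
  finally show ?eq .
qed

text \<open>Optional stopping for a bounded process with continuous paths. The time \<open>\<theta>\<close> is rounded up to a grid
  with \<open>n + 1\<close> cells; the stopped increment is then the sum of the increments over the cells that
  start strictly before \<open>\<theta>\<close>, and each of these has expectation zero by hypothesis. Refining
  the grid, path continuity and dominated convergence give the claim. The events
  \<open>{\<omega> \<in> L. q < \<theta> \<omega>}\<close> in the hypotheses say that the cell starting at \<open>q\<close> is counted.\<close>

lemma optional_stopping_continuous:
  fixes Y :: "real \<Rightarrow> 'w \<Rightarrow> real"
  assumes N: "prob_space N" and at: "a \<le> t"
    and Y: "\<And>q. q \<in> {a..t} \<Longrightarrow> Y q \<in> borel_measurable N"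
    and Ybd: "\<And>q \<omega>. q \<in> {a..t} \<Longrightarrow> \<omega> \<in> space N \<Longrightarrow> \<bar>Y q \<omega>\<bar> \<le> C"
    and Ycont: "\<And>\<omega>. \<omega> \<in> space N \<Longrightarrow> continuous_on {a..t} (\<lambda>q. Y q \<omega>)"
    and \<theta>: "\<And>\<omega>. \<omega> \<in> space N \<Longrightarrow> \<theta> \<omega> \<in> {a..t}"
    and L[measurable]: "L \<in> sets N"
    and alive: "\<And>q. q \<in> {a..t} \<Longrightarrow> {\<omega> \<in> L. q < \<theta> \<omega>} \<in> sets N"
    and mart: "\<And>q q'. a \<le> q \<Longrightarrow> q \<le> q' \<Longrightarrow> q' \<le> t \<Longrightarrow>
      (\<integral>\<omega>. (Y q' \<omega> - Y q \<omega>) * indicator {\<omega> \<in> L. q < \<theta> \<omega>} \<omega> \<partial>N) = 0"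
  shows "(\<integral>\<omega>. (Y (\<theta> \<omega>) \<omega> - Y a \<omega>) * indicator L \<omega> \<partial>N) = 0"
    and "(\<lambda>\<omega>. (Y (\<theta> \<omega>) \<omega> - Y a \<omega>) * indicator L \<omega>) \<in> borel_measurable N"
proof -
  interpret N: prob_space N by fact
  define h where "h n = (t - a) / real (Suc n)" for n
  define s where "s n k = a + real k * h n" for n k
  define K where "K n \<omega> = nat \<lceil>(\<theta> \<omega> - a) / h n\<rceil>" for n \<omega>
  define D where "D n \<omega> = (Y (s n (K n \<omega>)) \<omega> - Y a \<omega>) * indicator L \<omega>" for n \<omega>
  have h0: "0 \<le> h n" for n using at by (simp add: h_def)
  have s_mem: "s n k \<in> {a..t}" if "k \<le> Suc n" for n k
  proof -
    have "real k * h n \<le> real (Suc n) * h n"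
      using that h0 by (intro mult_right_mono) auto
    also have "\<dots> = t - a" by (simp add: h_def)
    finally show ?thesis using h0[of n] by (simp add: s_def)
  qed
  have s_le: "s n k \<le> s n (Suc k)" for n k
    using h0[of n] by (simp add: s_def algebra_simps)
  have deg: "\<theta> \<omega> = a" if "h n = 0" "\<omega> \<in> space N" for n \<omega>
    using that \<theta>[of \<omega>] by (auto simp: h_def)
  have K_le: "K n \<omega> \<le> Suc n" if "\<omega> \<in> space N" for n \<omega>
  proof (cases "h n = 0")
    case False
    then have "h n > 0" using h0[of n] by simp
    then have "(\<theta> \<omega> - a) / h n \<le> (t - a) / h n"
      using \<theta>[OF that] by (intro divide_right_mono) auto
    also have "\<dots> = real (Suc n)" using False by (auto simp: h_def)
    finally have "\<lceil>(\<theta> \<omega> - a) / h n\<rceil> \<le> int (Suc n)" by (simp add: ceiling_le_iff)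
    then show ?thesis unfolding K_def by linarith
  qed (simp add: K_def)
  \<comment> \<open>The cell \<open>k\<close> is counted exactly when its left end lies before \<open>\<theta>\<close>; strictness matches \<open>alive\<close>.\<close>
  have less_K: "k < K n \<omega> \<longleftrightarrow> s n k < \<theta> \<omega>" if "\<omega> \<in> space N" for n k \<omega>
  proof (cases "h n = 0")
    case True
    then show ?thesis using deg[OF True that] by (simp add: K_def s_def)
  next
    case False
    then have "h n > 0" using h0[of n] by simp
    have "k < K n \<omega> \<longleftrightarrow> int k < \<lceil>(\<theta> \<omega> - a) / h n\<rceil>" by (auto simp: K_def)
    also have "\<dots> \<longleftrightarrow> real k < (\<theta> \<omega> - a) / h n" by (simp add: less_ceiling_iff)
    also have "\<dots> \<longleftrightarrow> s n k < \<theta> \<omega>"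
      using \<open>h n > 0\<close> by (auto simp: s_def pos_less_divide_eq)
    finally show ?thesis .
  qed
  have sK: "\<bar>s n (K n \<omega>) - \<theta> \<omega>\<bar> \<le> h n" if "\<omega> \<in> space N" for n \<omega>
  proof (cases "h n = 0")
    case True
    then show ?thesis using deg[OF True that] by (simp add: K_def s_def)
  next
    case False
    then have "h n > 0" using h0[of n] by simp
    let ?y = "(\<theta> \<omega> - a) / h n"
    have "0 \<le> ?y" using \<open>h n > 0\<close> \<theta>[OF that] by auto
    then have "real (K n \<omega>) = of_int \<lceil>?y\<rceil>" by (simp add: K_def)
    then have "\<bar>real (K n \<omega>) - ?y\<bar> \<le> 1" by linarith
    then have "\<bar>real (K n \<omega>) - ?y\<bar> * h n \<le> 1 * h n" using h0 by (intro mult_right_mono)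
    moreover have "\<bar>real (K n \<omega>) - ?y\<bar> * h n = \<bar>(real (K n \<omega>) - ?y) * h n\<bar>"
      using h0[of n] by (simp add: abs_mult)
    moreover have "(real (K n \<omega>) - ?y) * h n = s n (K n \<omega>) - \<theta> \<omega>"
      using False by (simp add: s_def field_simps)
    ultimately show ?thesis by simp
  qed
  let ?I = "\<lambda>n k. indicator {\<omega> \<in> L. s n k < \<theta> \<omega>} :: 'w \<Rightarrow> real"
  \<comment> \<open>Telescoping over the cells that start before \<open>\<theta>\<close>.\<close>
  have D_sum: "D n \<omega> = (\<Sum>k<Suc n. (Y (s n (Suc k)) \<omega> - Y (s n k) \<omega>) * ?I n k \<omega>)"
    if w: "\<omega> \<in> space N" for n \<omega>
  proof -
    have "(\<Sum>k<Suc n. (Y (s n (Suc k)) \<omega> - Y (s n k) \<omega>) * ?I n k \<omega>)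
        = (\<Sum>k<Suc n. if k \<in> {..<K n \<omega>} then (Y (s n (Suc k)) \<omega> - Y (s n k) \<omega>) * indicator L \<omega> else 0)"
      by (rule sum.cong) (auto simp: less_K[OF w] split: split_indicator)
    also have "\<dots> = (\<Sum>k\<in>{..<Suc n} \<inter> {..<K n \<omega>}. (Y (s n (Suc k)) \<omega> - Y (s n k) \<omega>) * indicator L \<omega>)"
      by (rule sum.inter_restrict[symmetric]) simp
    also have "{..<Suc n} \<inter> {..<K n \<omega>} = {..<K n \<omega>}" using K_le[OF w, of n] by auto
    also have "(\<Sum>k<K n \<omega>. (Y (s n (Suc k)) \<omega> - Y (s n k) \<omega>) * indicator L \<omega>) = D n \<omega>"
      unfolding sum_distrib_right[symmetric] D_def
      by (subst sum_lessThan_telescope) (simp add: s_def)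
    finally show ?thesis by simp
  qed
  have term_int: "integrable N (\<lambda>\<omega>. (Y (s n (Suc k)) \<omega> - Y (s n k) \<omega>) * ?I n k \<omega>)"
    if "k < Suc n" for n k
  proof (rule N.integrable_bounded[where C = "2 * C"])
    have "s n k \<in> {a..t}" "s n (Suc k) \<in> {a..t}" using that by (auto intro!: s_mem simp del: atLeastAtMost_iff)
    note k = this
    show "(\<lambda>\<omega>. (Y (s n (Suc k)) \<omega> - Y (s n k) \<omega>) * ?I n k \<omega>) \<in> borel_measurable N"
      using Y[OF k(1)] Y[OF k(2)] alive[OF k(1)] by measurable
    show "\<bar>(Y (s n (Suc k)) \<omega> - Y (s n k) \<omega>) * ?I n k \<omega>\<bar> \<le> 2 * C" if "\<omega> \<in> space N" for \<omega>
      using Ybd[OF k(1) that] Ybd[OF k(2) that] by (auto split: split_indicator)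
  qed
  have D_meas: "D n \<in> borel_measurable N" for n
  proof -
    have "(\<lambda>\<omega>. \<Sum>k<Suc n. (Y (s n (Suc k)) \<omega> - Y (s n k) \<omega>) * ?I n k \<omega>) \<in> borel_measurable N"
      by (rule borel_measurable_sum) (rule borel_measurable_integrable[OF term_int], simp)
    then show ?thesis by (simp only: measurable_cong[OF D_sum])
  qed
  have D_int: "(\<integral>\<omega>. D n \<omega> \<partial>N) = 0" for n
  proof -
    have "(\<integral>\<omega>. D n \<omega> \<partial>N) = (\<integral>\<omega>. (\<Sum>k<Suc n. (Y (s n (Suc k)) \<omega> - Y (s n k) \<omega>) * ?I n k \<omega>) \<partial>N)"
      by (rule Bochner_Integration.integral_cong[OF refl D_sum])
    also have "\<dots> = (\<Sum>k<Suc n. (\<integral>\<omega>. (Y (s n (Suc k)) \<omega> - Y (s n k) \<omega>) * ?I n k \<omega> \<partial>N))"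
      by (rule Bochner_Integration.integral_sum) (auto intro: term_int)
    also have "\<dots> = 0"
    proof (rule sum.neutral, rule ballI)
      fix k assume "k \<in> {..<Suc n}"
      then have "s n k \<in> {a..t}" "s n (Suc k) \<in> {a..t}" by (auto intro!: s_mem simp del: atLeastAtMost_iff)
      then show "(\<integral>\<omega>. (Y (s n (Suc k)) \<omega> - Y (s n k) \<omega>) * ?I n k \<omega> \<partial>N) = 0"
        using mart[of "s n k" "s n (Suc k)"] s_le by auto
    qed
    finally show ?thesis .
  qed
  have h_lim: "h \<longlonglongrightarrow> 0"
    using tendsto_mult[OF tendsto_const LIMSEQ_Suc[OF lim_1_over_n], of "t - a"]
    by (simp add: h_def [abs_def])
  have D_lim: "(\<lambda>n. D n \<omega>) \<longlonglongrightarrow> (Y (\<theta> \<omega>) \<omega> - Y a \<omega>) * indicator L \<omega>" if w: "\<omega> \<in> space N" for \<omega>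
  proof -
    have "(\<lambda>n. s n (K n \<omega>) - \<theta> \<omega>) \<longlonglongrightarrow> 0"
      by (rule Lim_null_comparison[OF _ h_lim]) (simp add: sK[OF w])
    then have "(\<lambda>n. s n (K n \<omega>)) \<longlonglongrightarrow> \<theta> \<omega>" by (rule LIM_zero_cancel)
    then have "(\<lambda>n. Y (s n (K n \<omega>)) \<omega>) \<longlonglongrightarrow> Y (\<theta> \<omega>) \<omega>"
      using s_mem[OF K_le[OF w]]
      by (intro continuous_on_tendsto_compose[OF Ycont[OF w] _ \<theta>[OF w]]) auto
    then show ?thesis unfolding D_def by (intro tendsto_intros)
  qed
  show m: "(\<lambda>\<omega>. (Y (\<theta> \<omega>) \<omega> - Y a \<omega>) * indicator L \<omega>) \<in> borel_measurable N"
    by (rule borel_measurable_LIMSEQ_real[OF D_lim D_meas])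
  have "(\<lambda>n. \<integral>\<omega>. D n \<omega> \<partial>N) \<longlonglongrightarrow> (\<integral>\<omega>. (Y (\<theta> \<omega>) \<omega> - Y a \<omega>) * indicator L \<omega> \<partial>N)"
  proof (rule integral_dominated_convergence[where w = "\<lambda>_. 2 * \<bar>C\<bar>"])
    show "AE \<omega> in N. norm (D n \<omega>) \<le> 2 * \<bar>C\<bar>" for n
    proof (rule AE_I2)
      fix \<omega> assume w: "\<omega> \<in> space N"
      show "norm (D n \<omega>) \<le> 2 * \<bar>C\<bar>"
        using Ybd[OF s_mem[OF K_le[OF w]] w, of n] Ybd[OF _ w, of a] at
        by (auto simp: D_def split: split_indicator)
    qed
  qed (use m D_meas D_lim in auto)
  then show "(\<integral>\<omega>. (Y (\<theta> \<omega>) \<omega> - Y a \<omega>) * indicator L \<omega> \<partial>N) = 0"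
    by (simp add: D_int LIMSEQ_const_iff)
qed

section \<open>First hitting of a level\<close>

text \<open>The cap \<open>t\<close> belongs to the set so that the infimum is attained even by a path that avoids the
  level; the result is the minimum of \<open>t\<close> and the first hitting time after \<open>a\<close>.\<close>

definition first_hit :: "(real \<Rightarrow> real) \<Rightarrow> real \<Rightarrow> real \<Rightarrow> real \<Rightarrow> real" where
  "first_hit y r a t = Inf ({q \<in> {a..t}. y q = r} \<union> {t})"

context
  fixes y :: "real \<Rightarrow> real" and r a t :: real
  assumes cont: "continuous_on {a..t} y" and at: "a \<le> t"
begin

lemma first_hit_attained: "first_hit y r a t \<in> {q \<in> {a..t}. y q = r} \<union> {t}"
  unfolding first_hit_def
proof (rule closed_contains_Inf)
  show "bdd_below ({q \<in> {a..t}. y q = r} \<union> {t})"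
    using at by (intro bdd_belowI[of _ a]) auto
  show "closed ({q \<in> {a..t}. y q = r} \<union> {t})"
    using continuous_closed_preimage_constant[OF cont, of r] by (intro closed_Un) auto
qed simp

lemma first_hit_mem: "first_hit y r a t \<in> {a..t}"
  using first_hit_attained at by auto

lemma first_hit_le: "a \<le> q \<Longrightarrow> q \<le> t \<Longrightarrow> y q = r \<Longrightarrow> first_hit y r a t \<le> q"
  unfolding first_hit_def using at by (intro cInf_lower bdd_belowI[of _ a]) auto

lemma less_first_hit_iff:
  assumes "a \<le> q"
  shows "q < first_hit y r a t \<longleftrightarrow> q < t \<and> (\<forall>s\<in>{a..q}. y s \<noteq> r)"
proof
  assume L: "q < first_hit y r a t"
  then have "q < t" using first_hit_mem by auto
  moreover have "y s \<noteq> r" if "s \<in> {a..q}" for s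
    using first_hit_le[of s] that L \<open>q < t\<close> by fastforce
  ultimately show "q < t \<and> (\<forall>s\<in>{a..q}. y s \<noteq> r)" by blast
next
  assume R: "q < t \<and> (\<forall>s\<in>{a..q}. y s \<noteq> r)"
  show "q < first_hit y r a t"
  proof (rule ccontr)
    assume "\<not> q < first_hit y r a t"
    then show False using first_hit_attained first_hit_mem R by auto
  qed
qed

text \<open>Up to the hitting time the path stays on the side of the level on which it started, by the
  intermediate value theorem.\<close>

lemma first_hit_stays_below:
  assumes "y a \<le> r" "s \<in> {a..first_hit y r a t}"
  shows "y s \<le> r"
proof (rule ccontr)
  assume "\<not> y s \<le> r"
  then have gt: "r < y s" by simp
  have s: "a \<le> s" "s \<le> t" using assms(2) first_hit_mem by auto
  have "\<exists>x\<ge>a. x \<le> s \<and> y x = r"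
    using assms(1) gt s by (intro IVT' continuous_on_subset[OF cont]) auto
  then obtain x where x: "a \<le> x" "x \<le> s" "y x = r" by blast
  then have "first_hit y r a t \<le> x" using s by (intro first_hit_le) auto
  then have "x = s" using x assms(2) by auto
  with x gt show False by simp
qed

lemma first_hit_stays_above:
  assumes "r \<le> y a" "s \<in> {a..first_hit y r a t}"
  shows "r \<le> y s"
proof (rule ccontr)
  assume "\<not> r \<le> y s"
  then have gt: "y s < r" by simp
  have s: "a \<le> s" "s \<le> t" using assms(2) first_hit_mem by auto
  have "\<exists>x\<ge>a. x \<le> s \<and> y x = r"
    using assms(1) gt s by (intro IVT2' continuous_on_subset[OF cont]) auto
  then obtain x where x: "a \<le> x" "x \<le> s" "y x = r" by blast
  then have "first_hit y r a t \<le> x" using s by (intro first_hit_le) auto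
  then have "x = s" using x assms(2) by auto
  with x gt show False by simp
qed

end

text \<open>A path that avoids the level on a compact interval keeps a positive distance from it, and a lower bound
  on the distance extends from a dense set of times by continuity. Hence avoidance is determined by
  countably many times, which makes it an event. The affine parametrisation by \<open>(0, 1)\<close> treats the
  degenerate interval \<open>a = q\<close> together with the others.\<close>

lemma avoids_level_iff_rational:
  fixes y :: "real \<Rightarrow> real"
  assumes cont: "continuous_on {a..q} y" and aq: "a \<le> q"
  shows "(\<forall>s\<in>{a..q}. y s \<noteq> r) \<longleftrightarrow>
    (\<exists>n. \<forall>x\<in>\<rat> \<inter> {0<..<1}. 1 / real (Suc n) \<le> \<bar>y (a + x * (q - a)) - r\<bar>)"
proof
  assume L: "\<forall>s\<in>{a..q}. y s \<noteq> r"
  have "\<exists>s\<in>{a..q}. \<forall>s'\<in>{a..q}. \<bar>y s - r\<bar> \<le> \<bar>y s' - r\<bar>"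
    using aq by (intro continuous_attains_inf continuous_intros cont) auto
  then obtain s where s: "s \<in> {a..q}" "\<And>s'. s' \<in> {a..q} \<Longrightarrow> \<bar>y s - r\<bar> \<le> \<bar>y s' - r\<bar>" by blast
  then have "0 < \<bar>y s - r\<bar>" using L by simp
  then obtain n where n: "inverse (real (Suc n)) < \<bar>y s - r\<bar>" by (rule reals_Archimedean[THEN exE])
  have "1 / real (Suc n) \<le> \<bar>y (a + x * (q - a)) - r\<bar>" if "x \<in> \<rat> \<inter> {0<..<1}" for x
  proof -
    have "x * (q - a) \<le> 1 * (q - a)" using that aq by (intro mult_right_mono) auto
    then have "a + x * (q - a) \<in> {a..q}" using that aq by auto
    from s(2)[OF this] n show ?thesis by (simp add: inverse_eq_divide)
  qed
  then show "\<exists>n. \<forall>x\<in>\<rat> \<inter> {0<..<1}. 1 / real (Suc n) \<le> \<bar>y (a + x * (q - a)) - r\<bar>" by blast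
next
  assume "\<exists>n. \<forall>x\<in>\<rat> \<inter> {0<..<1}. 1 / real (Suc n) \<le> \<bar>y (a + x * (q - a)) - r\<bar>"
  then obtain n where n: "\<And>x. x \<in> \<rat> \<inter> {0<..<1} \<Longrightarrow> 1 / real (Suc n) \<le> \<bar>y (a + x * (q - a)) - r\<bar>"
    by blast
  have "{0<..<1} \<subseteq> closure ({0<..<1} \<inter> \<rat> :: real set)"
    using open_Int_closure_subset[of "{0<..<1::real}" \<rat>] by (simp add: Rats_closure_real)
  then have "closure {0<..<1::real} \<subseteq> closure ({0<..<1} \<inter> \<rat>)"
    by (rule closure_minimal) simp
  moreover have "closure ({0<..<1} \<inter> \<rat>) \<subseteq> closure {0<..<1::real}"
    by (intro closure_mono) simp
  ultimately have cl: "closure (\<rat> \<inter> {0<..<1::real}) = {0..1}"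
    by (auto simp: Int_commute)
  have "continuous_on (closure (\<rat> \<inter> {0<..<1})) (\<lambda>x. \<bar>y (a + x * (q - a)) - r\<bar>)"
    unfolding cl
  proof (intro continuous_intros continuous_on_compose2[OF cont] subsetI)
    fix z assume "z \<in> (\<lambda>x. a + x * (q - a)) ` {0..1}"
    then obtain x where "z = a + x * (q - a)" "x \<in> {0..1}" by blast
    moreover from this have "x * (q - a) \<le> 1 * (q - a)" using aq by (intro mult_right_mono) auto
    ultimately show "z \<in> {a..q}" using aq by auto
  qed
  note ge = continuous_ge_on_closure[OF this _ n]
  show "\<forall>s\<in>{a..q}. y s \<noteq> r"
  proof
    fix s assume s: "s \<in> {a..q}"
    obtain x where x: "x \<in> {0..1}" "s = a + x * (q - a)"
    proof (cases "q = a")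
      case True
      with s that[of 0] show thesis by simp
    next
      case False
      with s that[of "(s - a) / (q - a)"] show thesis by (simp add: field_simps)
    qed
    have "1 / real (Suc n) \<le> \<bar>y s - r\<bar>" using ge[of x] x by (simp add: cl)
    moreover have "0 < 1 / real (Suc n)" by simp
    ultimately show "y s \<noteq> r" by fastforce
  qed
qed

section \<open>Continuous functions on the star graph\<close>

lemma radial_dist_le: "\<bar>radial u - radial w\<bar> \<le> dist u w"
proof -
  have "dist (pt undefined 0) u \<le> dist (pt undefined 0) w + dist u w"
    using dist_triangle[of "pt undefined 0" u w] by (simp add: dist_commute)
  moreover have "dist (pt undefined 0) w \<le> dist (pt undefined 0) u + dist u w"
    by (rule dist_triangle)
  ultimately show ?thesis by (simp add: dist_vertex)
qed

lemma continuous_on_radial [continuous_intros]: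
  fixes h :: "'b::topological_space \<Rightarrow> 'a star"
  assumes "continuous_on S h" shows "continuous_on S (\<lambda>x. radial (h x))"
proof -
  have "continuous_on UNIV (radial :: 'a star \<Rightarrow> real)"
    unfolding continuous_on_iff dist_real_def using radial_dist_le order_le_less_trans by blast
  then show ?thesis using assms by (rule continuous_on_compose2) auto
qed

lemma radial_borel [measurable]: "radial \<in> borel_measurable borel"
  by (intro borel_measurable_continuous_onI continuous_on_radial continuous_on_id)

lemma continuous_on_pt: "continuous_on S (pt j)"
  unfolding continuous_on_iff
proof (intro ballI allI impI)
  fix x e :: real assume "0 < e"
  have "dist (pt j x') (pt j x) \<le> dist x' x" for x'
  proof -
    have "pt j z = pt j (max 0 z)" for z by transfer (simp add: star_rel_def)
    then have "dist (pt j x') (pt j x) = \<bar>max 0 x' - max 0 x\<bar>"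
      using dist_pt[of "max 0 x'" "max 0 x" j j] by simp
    then show ?thesis by (simp add: dist_real_def)
  qed
  with \<open>0 < e\<close> show "\<exists>d>0. \<forall>x'\<in>S. dist x' x < d \<longrightarrow> dist (pt j x') (pt j x) < e"
    using order_le_less_trans by blast
qed

lemma compact_radial_ball: "compact {u :: 'n::finite star. radial u \<le> R}"
proof -
  have "{u :: 'n star. radial u \<le> R} = (\<Union>j. pt j ` {0..R})"
  proof (intro equalityI subsetI)
    fix u :: "'n star" assume "u \<in> {u. radial u \<le> R}"
    moreover obtain j x where "0 \<le> x" "u = pt j x" "radial u = x" by (rule pt_radial_cases)
    ultimately have "u = pt j x" "x \<in> {0..R}" by auto
    then show "u \<in> (\<Union>j. pt j ` {0..R})" by blast
  qed auto
  then show ?thesis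
    by (auto intro!: compact_UN compact_continuous_image continuous_on_pt)
qed

lemma C0_bounded:
  fixes f :: "'n::finite star \<Rightarrow> real"
  assumes f: "f \<in> C0"
  obtains C where "0 \<le> C" "\<And>u. \<bar>f u\<bar> \<le> C"
proof -
  have cont: "continuous_on UNIV f" and lim: "(f \<longlongrightarrow> 0) (filtercomap radial at_top)"
    using f by (auto simp: C0_def)
  from tendstoD[OF lim, of 1] obtain R where R: "\<And>u. R \<le> radial u \<Longrightarrow> \<bar>f u\<bar> < 1"
    by (auto simp: eventually_filtercomap eventually_at_top_linorder)
  have "bounded (f ` {u. radial u \<le> R})"
    by (intro compact_imp_bounded compact_continuous_image compact_radial_ball
        continuous_on_subset[OF cont]) simp
  then obtain B where B: "\<And>u. radial u \<le> R \<Longrightarrow> \<bar>f u\<bar> \<le> B"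
    by (auto simp: bounded_iff)
  show thesis
  proof (rule that[of "max 1 B"])
    show "\<bar>f u\<bar> \<le> max 1 B" for u
      using R[of u] B[of u] by (cases "radial u \<le> R") auto
  qed simp
qed

lemma C0_borel: "f \<in> C0 \<Longrightarrow> f \<in> borel_measurable borel"
  by (intro borel_measurable_continuous_onI) (simp add: C0_def)

section \<open>The Markov property and Dynkin's formula\<close>

text \<open>Dynkin's formula and its consequences hold for every continuous Feller process on the star graph; the vertex
  condition only enters later, through the choice of test functions in the domain of the generator.\<close>

locale feller_process =
  fixes M :: "'w measure" and P :: "'n::finite star \<Rightarrow> 'w measure" and X :: "real \<Rightarrow> 'w \<Rightarrow> 'n star"
  assumes markov: "continuous_strong_markov M P X"
    and semigroup: "C0_semigroup (transition_semigroup P X)"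
begin

abbreviation "F q \<equiv> natural_filtration M X (ennreal q)"

lemma prob: "prob_space (P u)" and sets_P [measurable_cong]: "sets (P u) = sets M"
  using markov by (auto simp: continuous_strong_markov_def)

lemma space_P: "space (P u) = space M"
  using sets_eq_imp_space_eq[OF sets_P] .

lemma path_continuous: "\<omega> \<in> space M \<Longrightarrow> continuous_on {0..} (\<lambda>q. X q \<omega>)"
  using markov by (auto simp: continuous_strong_markov_def)

lemma X_measurable: "0 \<le> q \<Longrightarrow> X q \<in> borel_measurable M"
  using markov by (auto simp: continuous_strong_markov_def)

lemma start: "AE \<omega> in P u. X 0 \<omega> = u"
  using markov by (auto simp: continuous_strong_markov_def)

lemma space_F: "space (F q) = space M"
  using filtration.space_F[OF filtration_natural] .

lemma F_mono: "q \<le> q' \<Longrightarrow> sets (F q) \<subseteq> sets (F q')"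
  by (rule filtration.sets_F_mono[OF filtration_natural ennreal_leI])

lemma X_F_measurable:
  assumes "0 \<le> s" "s \<le> q"
  shows "X s \<in> borel_measurable (F q)"
proof (rule measurableI)
  fix B :: "'n star set" assume B: "B \<in> sets borel"
  have "X s -` B \<inter> space M \<in> {X s -` B \<inter> space M | s B. 0 \<le> s \<and> ennreal s \<le> ennreal q \<and> B \<in> sets borel}"
    using assms B by (auto intro!: ennreal_leI)
  then show "X s -` B \<inter> space (F q) \<in> sets (F q)"
    unfolding space_F unfolding natural_filtration_def by (subst sets_measure_of) auto
qed simp

lemma sets_F_subset:
  assumes "A \<in> sets (F q)" shows "A \<in> sets M"
proof -
  have "sets (F q) \<subseteq> sets M"
    unfolding natural_filtration_def
    by (subst sets_measure_of)
      (auto intro!: sets.sigma_sets_subset measurable_sets[OF X_measurable])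
  then show ?thesis using assms by auto
qed

text \<open>The first hitting time of a sphere is a stopping time of the natural filtration, because the path
  avoids the sphere up to time \<open>q\<close> if and only if it does so, uniformly, at countably many times before
  \<open>q\<close>. The intersection with an event \<open>L\<close> known at time \<open>a\<close> is what optional stopping on \<open>L\<close> asks for.\<close>

lemma first_hit_alive_measurable:
  assumes "0 \<le> a" "a \<le> q" "q \<le> t" and L: "L \<in> sets (F a)"
  shows "{\<omega> \<in> L. q < first_hit (\<lambda>s. radial (X s \<omega>)) r a t} \<in> sets (F q)"
proof (cases "q < t")
  case True
  let ?G = "{\<omega> \<in> space (F q). \<exists>n. \<forall>x\<in>\<rat> \<inter> {0<..<1}.
     1 / real (Suc n) \<le> \<bar>radial (X (a + x * (q - a)) \<omega>) - r\<bar>}"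
  have X': "X (a + x * (q - a)) \<in> borel_measurable (F q)" if "x \<in> \<rat> \<inter> {0<..<1}" for x
  proof (rule X_F_measurable)
    have "x * (q - a) \<le> 1 * (q - a)" using that assms by (intro mult_right_mono) auto
    then show "a + x * (q - a) \<le> q" by simp
  qed (use that assms in auto)
  have "?G \<in> sets (F q)"
  proof (intro sets.sets_Collect_countable_Ex sets.sets_Collect_countable_All')
    fix n x assume "x \<in> \<rat> \<inter> {0<..<1 :: real}"
    note this[THEN X', measurable]
    show "{\<omega> \<in> space (F q). 1 / real (Suc n) \<le> \<bar>radial (X (a + x * (q - a)) \<omega>) - r\<bar>} \<in> sets (F q)"
      by measurable
  qed (auto intro: countable_rat countable_subset)
  moreover have "{\<omega> \<in> L. q < first_hit (\<lambda>s. radial (X s \<omega>)) r a t} = L \<inter> ?G"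
  proof -
    have "q < first_hit (\<lambda>s. radial (X s \<omega>)) r a t \<longleftrightarrow> \<omega> \<in> ?G" if "\<omega> \<in> L" for \<omega>
    proof -
      have w: "\<omega> \<in> space M" using that L sets.sets_into_space[of L "F a"] by (auto simp: space_F)
      have c: "continuous_on S (\<lambda>s. radial (X s \<omega>))" if "S \<subseteq> {0..}" for S
        using that by (intro continuous_on_radial continuous_on_subset[OF path_continuous[OF w]])
      have "q < first_hit (\<lambda>s. radial (X s \<omega>)) r a t \<longleftrightarrow> (\<forall>s\<in>{a..q}. radial (X s \<omega>) \<noteq> r)"
        using True assms by (subst less_first_hit_iff) (auto intro!: c)
      also have "\<dots> \<longleftrightarrow> \<omega> \<in> ?G"
        using assms w by (subst avoids_level_iff_rational) (auto intro!: c simp: space_F)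
      finally show ?thesis .
    qed
    then show ?thesis by blast
  qed
  moreover have "L \<in> sets (F q)" using L F_mono assms by blast
  ultimately show ?thesis by simp
next
  case False
  have "\<not> q < first_hit (\<lambda>s. radial (X s \<omega>)) r a t" if "\<omega> \<in> L" for \<omega>
  proof -
    have w: "\<omega> \<in> space M" using that L sets.sets_into_space[of L "F a"] by (auto simp: space_F)
    have "continuous_on {a..t} (\<lambda>s. radial (X s \<omega>))"
      using assms by (intro continuous_on_radial continuous_on_subset[OF path_continuous[OF w]]) auto
    moreover have "a \<le> t" using assms by simp
    ultimately show ?thesis using first_hit_mem[of a t _ r] False by fastforce
  qed
  then have "{\<omega> \<in> L. q < first_hit (\<lambda>s. radial (X s \<omega>)) r a t} = {}" by blast
  then show ?thesis by (simp only: sets.empty_sets)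
qed

text \<open>The strong Markov property at a constant time.\<close>

lemma markov_property:
  assumes "0 \<le> s" "0 \<le> h" and L: "L \<in> sets (F s)" and f: "f \<in> C0"
  shows "(\<integral>\<omega>. f (X (s + h) \<omega>) * indicator L \<omega> \<partial>P u)
    = (\<integral>\<omega>. transition_semigroup P X h f (X s \<omega>) * indicator L \<omega> \<partial>P u)"
proof -
  interpret filtration "space M" "natural_filtration M X" by (rule filtration_natural)
  have st: "stopping_time (natural_filtration M X) (\<lambda>_. ennreal s)" by (rule stopping_time_const)
  have "L \<in> sets (pre_sigma (\<lambda>_. ennreal s))"
  proof (rule sets_pre_sigmaI[OF st])
    fix t show "{\<omega> \<in> L. ennreal s \<le> t} \<in> sets (natural_filtration M X t)"
      using sets_F_mono[of "ennreal s" t] L by (cases "ennreal s \<le> t") auto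
  qed
  moreover obtain C where "\<And>u. \<bar>f u\<bar> \<le> C" by (rule C0_bounded[OF f]) blast
  then have "bounded (range f)" by (auto simp: bounded_iff)
  moreover note C0_borel[OF f] st assms(2)
  moreover have "\<forall>\<tau> \<Lambda> t f u.
        stopping_time (natural_filtration M X) \<tau> \<longrightarrow>
        \<Lambda> \<in> sets (filtration.pre_sigma (space M) (natural_filtration M X) \<tau>) \<longrightarrow>
        0 \<le> t \<longrightarrow> f \<in> borel_measurable borel \<longrightarrow> bounded (range f) \<longrightarrow>
        (LINT \<omega>:\<Lambda> \<inter> {\<omega>. \<tau> \<omega> < \<infinity>}|P u. f (X (enn2real (\<tau> \<omega>) + t) \<omega>)) =
        (LINT \<omega>:\<Lambda> \<inter> {\<omega>. \<tau> \<omega> < \<infinity>}|P u. transition_semigroup P X t f (X (enn2real (\<tau> \<omega>)) \<omega>))"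
    using markov unfolding continuous_strong_markov_def by (elim conjE)
  ultimately have "(LINT \<omega>:L \<inter> {\<omega>. ennreal s < \<infinity>}|P u. f (X (enn2real (ennreal s) + h) \<omega>)) =
        (LINT \<omega>:L \<inter> {\<omega>. ennreal s < \<infinity>}|P u. transition_semigroup P X h f (X (enn2real (ennreal s)) \<omega>))"
    by blast
  then show ?thesis using assms(1) by (simp add: set_lebesgue_integral_def mult.commute)
qed

lemma observable_measurable: "0 \<le> q \<Longrightarrow> f \<in> C0 \<Longrightarrow> (\<lambda>\<omega>. f (X q \<omega>)) \<in> borel_measurable (P u)"
  using measurable_compose[OF X_measurable C0_borel]
  by (subst measurable_cong_sets[OF sets_P refl]) auto

lemma observable_continuous:
  assumes "f \<in> C0" "\<omega> \<in> space M"
  shows "continuous_on UNIV (\<lambda>q. f (X (max 0 q) \<omega>))"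
proof -
  have "continuous_on UNIV (\<lambda>q. X (max 0 q) \<omega>)"
    by (rule continuous_on_compose2[OF path_continuous[OF assms(2)]]) (auto intro!: continuous_intros)
  moreover have "continuous_on UNIV f" using assms(1) by (simp add: C0_def)
  ultimately show ?thesis using continuous_on_compose2[of UNIV f UNIV "\<lambda>q. X (max 0 q) \<omega>"] by simp
qed

lemma expectation_continuous:
  assumes g: "g \<in> C0" and L: "L \<in> sets M"
  shows "continuous_on {0..} (\<lambda>q. \<integral>\<omega>. g (X q \<omega>) * indicator L \<omega> \<partial>P u)"
  unfolding continuous_on_sequentially
proof (intro allI ballI impI)
  fix x :: "nat \<Rightarrow> real" and q :: real
  assume q: "q \<in> {0..}" and x: "(\<forall>n. x n \<in> {0..}) \<and> x \<longlonglongrightarrow> q"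
  interpret prob_space "P u" by (rule prob)
  have L'[measurable]: "L \<in> sets (P u)" using L by (simp add: sets_P)
  obtain C where C: "0 \<le> C" "\<And>u. \<bar>g u\<bar> \<le> C" by (rule C0_bounded[OF g]) blast
  show "((\<lambda>q. \<integral>\<omega>. g (X q \<omega>) * indicator L \<omega> \<partial>P u) \<circ> x) \<longlonglongrightarrow> (\<integral>\<omega>. g (X q \<omega>) * indicator L \<omega> \<partial>P u)"
    unfolding o_def
  proof (rule integral_dominated_convergence[where w = "\<lambda>_. C"])
    show "AE \<omega> in P u. (\<lambda>n. g (X (x n) \<omega>) * indicator L \<omega>) \<longlonglongrightarrow> g (X q \<omega>) * indicator L \<omega>"
    proof (rule AE_I2)
      fix \<omega> assume "\<omega> \<in> space (P u)"
      then have "continuous_on UNIV (\<lambda>q. g (X (max 0 q) \<omega>))"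
        using observable_continuous[OF g] by (simp add: space_P)
      then have "(\<lambda>n. g (X (max 0 (x n)) \<omega>)) \<longlonglongrightarrow> g (X (max 0 q) \<omega>)"
        using x by (intro continuous_on_tendsto_compose[where f = "\<lambda>q. g (X (max 0 q) \<omega>)"]) auto
      then have "(\<lambda>n. g (X (x n) \<omega>)) \<longlonglongrightarrow> g (X q \<omega>)" using x q by simp
      then show "(\<lambda>n. g (X (x n) \<omega>) * indicator L \<omega>) \<longlonglongrightarrow> g (X q \<omega>) * indicator L \<omega>"
        by (intro tendsto_intros)
    qed
    show "(\<lambda>\<omega>. g (X q \<omega>) * indicator L \<omega>) \<in> borel_measurable (P u)"
      using observable_measurable[OF _ g] q by (intro borel_measurable_times) auto
    show "(\<lambda>\<omega>. g (X (x n) \<omega>) * indicator L \<omega>) \<in> borel_measurable (P u)" for n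
      using observable_measurable[OF _ g] x by (intro borel_measurable_times) auto
    show "AE \<omega> in P u. norm (g (X (x n) \<omega>) * indicator L \<omega>) \<le> C" for n
      using C by (intro AE_I2) (simp split: split_indicator)
    show "integrable (P u) (\<lambda>_. C)" by (rule integrable_const)
  qed
qed

text \<open>By the Markov property the increment of \<open>E[f(X)]\<close> on an event \<open>L\<close> of the past is the expectation of
  \<open>T\<^sub>h f - f\<close> at the present position. Therefore the uniform error in the definition of the generator
  controls the difference quotient at every time \<open>s\<close> with the same bound.\<close>

lemma expectation_difference_quotient:
  assumes f: "f \<in> C0" and g: "g \<in> C0" and L: "L \<in> sets (F s)" and "0 \<le> s" "0 < h"
    and bd: "\<And>u. \<bar>(transition_semigroup P X h f u - f u) / h - g u\<bar> \<le> e"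
  shows "\<bar>((\<integral>\<omega>. f (X (s + h) \<omega>) * indicator L \<omega> \<partial>P u) - (\<integral>\<omega>. f (X s \<omega>) * indicator L \<omega> \<partial>P u)) / h
    - (\<integral>\<omega>. g (X s \<omega>) * indicator L \<omega> \<partial>P u)\<bar> \<le> e"
proof -
  interpret prob_space "P u" by (rule prob)
  let ?Tf = "transition_semigroup P X h f"
  have Tf: "?Tf \<in> C0" using semigroup f \<open>0 < h\<close> by (auto simp: C0_semigroup_def)
  have L'[measurable]: "L \<in> sets (P u)" using sets_F_subset[OF L] by (simp add: sets_P)
  have int: "integrable (P u) (\<lambda>\<omega>. k (X s \<omega>) * indicator L \<omega>)" if k: "k \<in> C0" for k
  proof -
    obtain C where C: "0 \<le> C" "\<And>u. \<bar>k u\<bar> \<le> C" by (rule C0_bounded[OF k]) blast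
    show ?thesis
    proof (rule integrable_bounded)
      show "(\<lambda>\<omega>. k (X s \<omega>) * indicator L \<omega>) \<in> borel_measurable (P u)"
        using observable_measurable[OF \<open>0 \<le> s\<close> k] by (intro borel_measurable_times) auto
    qed (use C in \<open>auto split: split_indicator\<close>)
  qed
  have "((\<integral>\<omega>. f (X (s + h) \<omega>) * indicator L \<omega> \<partial>P u) - (\<integral>\<omega>. f (X s \<omega>) * indicator L \<omega> \<partial>P u)) / h
    - (\<integral>\<omega>. g (X s \<omega>) * indicator L \<omega> \<partial>P u)
    = ((\<integral>\<omega>. ?Tf (X s \<omega>) * indicator L \<omega> \<partial>P u) - (\<integral>\<omega>. f (X s \<omega>) * indicator L \<omega> \<partial>P u)) / h
    - (\<integral>\<omega>. g (X s \<omega>) * indicator L \<omega> \<partial>P u)"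
    using markov_property[OF \<open>0 \<le> s\<close> _ L f, of h] \<open>0 < h\<close> by simp
  also have "\<dots> = (\<integral>\<omega>. (?Tf (X s \<omega>) * indicator L \<omega> - f (X s \<omega>) * indicator L \<omega>) / h
      - g (X s \<omega>) * indicator L \<omega> \<partial>P u)"
    by (simp add: int[OF Tf] int[OF f] int[OF g])
  also have "\<bar>\<dots>\<bar> \<le> (\<integral>\<omega>. e \<partial>P u)"
  proof (rule order_trans[OF integral_abs_bound], rule integral_mono)
    fix \<omega>
    have "0 \<le> e" using bd order_trans abs_ge_zero by blast
    then show "\<bar>(?Tf (X s \<omega>) * indicator L \<omega> - f (X s \<omega>) * indicator L \<omega>) / h
      - g (X s \<omega>) * indicator L \<omega>\<bar> \<le> e"
      using bd[of "X s \<omega>"] by (auto split: split_indicator)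
  qed (intro integrable_abs Bochner_Integration.integrable_diff integrable_divide int Tf f g integrable_const)+
  also have "(\<integral>\<omega>. e \<partial>P u) = e" by (simp add: prob_space)
  finally show ?thesis .
qed

text \<open>The Kolmogorov forward equation \<open>d/dq E[f(X\<^sub>q); L] = E[g(X\<^sub>q); L]\<close>. The generator provides right
  derivatives only; because the bound of the preceding lemma is uniform in time, it may be applied at
  the left one of the two times, and continuity of \<open>E[g(X\<^sub>q); L]\<close> turns this into a two-sided derivative.\<close>

lemma expectation_derivative:
  assumes gen: "(f, g) \<in> generator (transition_semigroup P X)"
    and s: "0 \<le> s" and L: "L \<in> sets (F s)" and q: "s \<le> q" "q \<le> t"
  shows "((\<lambda>q. \<integral>\<omega>. f (X q \<omega>) * indicator L \<omega> \<partial>P u) has_real_derivative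
    (\<integral>\<omega>. g (X q \<omega>) * indicator L \<omega> \<partial>P u)) (at q within {s..t})"
proof -
  have f: "f \<in> C0" and g: "g \<in> C0"
    and ul: "uniform_limit UNIV (\<lambda>t u. (transition_semigroup P X t f u - f u) / t) g (at_right 0)"
    using gen by (auto simp: generator_def)
  define m where "m q = (\<integral>\<omega>. f (X q \<omega>) * indicator L \<omega> \<partial>P u)" for q
  define G where "G q = (\<integral>\<omega>. g (X q \<omega>) * indicator L \<omega> \<partial>P u)" for q
  have close: "((\<lambda>z. (m z - m q) / (z - q) - G (min z q)) \<longlongrightarrow> 0) (at q within {s..t})"
  proof (rule tendstoI)
    fix e :: real assume "0 < e"
    then have "\<forall>\<^sub>F h in at_right 0. \<forall>u\<in>UNIV. dist ((transition_semigroup P X h f u - f u) / h) (g u) < e / 2"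
      by (intro uniform_limitD[OF ul]) simp
    then obtain d where d: "0 < d" "\<And>h u. 0 < h \<Longrightarrow> h < d \<Longrightarrow>
        \<bar>(transition_semigroup P X h f u - f u) / h - g u\<bar> < e / 2"
      by (auto simp: eventually_at_right[OF zero_less_one] dist_real_def)
    have quot: "\<bar>(m z2 - m z1) / (z2 - z1) - G z1\<bar> < e" if "s \<le> z1" "z1 < z2" "z2 - z1 < d" for z1 z2
    proof -
      have "L \<in> sets (F z1)" using L F_mono that(1) by blast
      from expectation_difference_quotient[OF f g this, of "z2 - z1" "e / 2" u] that s d(2)[of "z2 - z1"]
      have "\<bar>(m z2 - m z1) / (z2 - z1) - G z1\<bar> \<le> e / 2"
        by (simp add: m_def G_def less_imp_le)
      then show ?thesis using \<open>0 < e\<close> by simp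
    qed
    show "\<forall>\<^sub>F z in at q within {s..t}. dist ((m z - m q) / (z - q) - G (min z q)) 0 < e"
      unfolding eventually_at
    proof (intro exI[of _ d] conjI ballI impI)
      fix z assume z: "z \<in> {s..t}" "z \<noteq> q \<and> dist z q < d"
      show "dist ((m z - m q) / (z - q) - G (min z q)) 0 < e"
      proof (cases "q < z")
        case True
        then show ?thesis using quot[of q z] z q by (simp add: dist_real_def)
      next
        case False
        then have "z < q" using z by simp
        moreover have "(m z - m q) / (z - q) = (m q - m z) / (q - z)"
          using minus_divide_divide[of "m q - m z" "q - z"] by simp
        ultimately show ?thesis using quot[of z q] z by (simp add: dist_real_def)
      qed
    qed (rule d)
  qed
  have "continuous_on {0..} G"
    unfolding G_def using g sets_F_subset[OF L] by (rule expectation_continuous)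
  then have "continuous_on {s..t} (\<lambda>z. G (min z q))"
    by (rule continuous_on_compose2) (use s q in \<open>auto intro!: continuous_intros\<close>)
  from bspec[OF this[unfolded continuous_on_def], of q] q
  have "((\<lambda>z. G (min z q)) \<longlongrightarrow> G q) (at q within {s..t})" by simp
  from tendsto_add[OF close this]
  have "((\<lambda>z. (m z - m q) / (z - q)) \<longlongrightarrow> G q) (at q within {s..t})" by simp
  then show ?thesis unfolding has_field_derivative_iff m_def G_def .
qed

text \<open>Dynkin's formula at the first hitting time of a sphere after time \<open>a\<close>, restricted to an event
  known at time \<open>a\<close>: the process \<open>f(X\<^sub>q) - \<integral>\<^sub>a\<^sup>q g(X\<^sub>s) ds\<close> is a bounded martingale on \<open>{a..t}\<close>, and
  optional stopping applies to it.\<close>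

lemma dynkin_first_hit:
  fixes r a t :: real
  assumes gen: "(f, g) \<in> generator (transition_semigroup P X)"
    and a: "0 \<le> a" "a \<le> t" and L: "L \<in> sets (F a)"
  defines "\<theta> \<equiv> \<lambda>\<omega>. first_hit (\<lambda>s. radial (X s \<omega>)) r a t"
  defines "D \<equiv> \<lambda>\<omega>. (f (X (\<theta> \<omega>) \<omega>) - integral {a..\<theta> \<omega>} (\<lambda>s. g (X s \<omega>)) - f (X a \<omega>)) * indicator L \<omega>"
  shows "integrable (P u) D" and "(\<integral>\<omega>. D \<omega> \<partial>P u) = 0"
proof -
  interpret prob_space "P u" by (rule prob)
  have f: "f \<in> C0" and g: "g \<in> C0" using gen by (auto simp: generator_def)
  obtain Cf where Cf: "0 \<le> Cf" "\<And>u. \<bar>f u\<bar> \<le> Cf" by (rule C0_bounded[OF f]) blast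
  obtain Cg where Cg: "0 \<le> Cg" "\<And>u. \<bar>g u\<bar> \<le> Cg" by (rule C0_bounded[OF g]) blast
  define Z where "Z q \<omega> = g (X (max 0 q) \<omega>)" for q \<omega>
  define Y where "Y q \<omega> = f (X q \<omega>) - integral {a..q} (\<lambda>s. Z s \<omega>)" for q \<omega>
  have Zm: "Z q \<in> borel_measurable (P u)" for q
    unfolding Z_def by (rule observable_measurable[OF _ g]) simp
  have Zc: "continuous_on UNIV (\<lambda>q. Z q \<omega>)" if "\<omega> \<in> space (P u)" for \<omega>
    unfolding Z_def using that by (intro observable_continuous[OF g]) (simp add: space_P)
  have Zi: "(\<lambda>s. Z s \<omega>) integrable_on {q..q'}" if "\<omega> \<in> space (P u)" for q q' \<omega>
    by (rule integrable_continuous_real[OF continuous_on_subset[OF Zc[OF that]]]) simp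
  have L_sub: "L' \<in> sets (P u)" if "L' \<in> sets (F q)" for L' q
    using sets_F_subset[OF that] by (simp add: sets_P)
  \<comment> \<open>The martingale property, stated for \<open>f\<close> and the integral separately.\<close>
  have increment: "(\<integral>\<omega>. integral {q..q'} (\<lambda>s. Z s \<omega>) * indicator L' \<omega> \<partial>P u) =
      (\<integral>\<omega>. f (X q' \<omega>) * indicator L' \<omega> \<partial>P u) - (\<integral>\<omega>. f (X q \<omega>) * indicator L' \<omega> \<partial>P u)"
    and Im: "(\<lambda>\<omega>. integral {q..q'} (\<lambda>s. Z s \<omega>)) \<in> borel_measurable (P u)"
    if q: "a \<le> q" "q \<le> q'" and L': "L' \<in> sets (F q)" for q q' L'
  proof -
    have d: "((\<lambda>q. \<integral>\<omega>. f (X q \<omega>) * indicator L' \<omega> \<partial>P u) has_real_derivative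
         (\<integral>\<omega>. Z x \<omega> * indicator L' \<omega> \<partial>P u)) (at x within {q..q'})" if "q \<le> x" "x \<le> q'" for x
      using expectation_derivative[OF gen _ L' that, of u] a q that by (simp add: Z_def)
    note * = expectation_increment[where N = "P u" and Y = "\<lambda>q \<omega>. f (X q \<omega>)" and Z = Z and L = L'
        and s = q and t = q' and C = Cg]
    have Zb: "\<bar>Z q \<omega>\<bar> \<le> Cg" for q \<omega> by (simp add: Z_def Cg)
    show "(\<integral>\<omega>. integral {q..q'} (\<lambda>s. Z s \<omega>) * indicator L' \<omega> \<partial>P u) =
      (\<integral>\<omega>. f (X q' \<omega>) * indicator L' \<omega> \<partial>P u) - (\<integral>\<omega>. f (X q \<omega>) * indicator L' \<omega> \<partial>P u)"
      by (rule *(1)) (fact prob Zm Zc Zb L_sub[OF L'] q(2) d)+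
    show "(\<lambda>\<omega>. integral {q..q'} (\<lambda>s. Z s \<omega>)) \<in> borel_measurable (P u)"
      by (rule *(2)) (fact prob Zm Zc Zb L_sub[OF L'] q(2) d)+
  qed
  have Ibd: "\<bar>integral {q..q'} (\<lambda>s. Z s \<omega>)\<bar> \<le> Cg * (t - a)"
    if "a \<le> q" "q \<le> q'" "q' \<le> t" "\<omega> \<in> space (P u)" for q q' \<omega>
  proof -
    have "norm (integral {q..q'} (\<lambda>s. Z s \<omega>)) \<le> Cg * (q' - q)"
      using that by (intro integral_bound continuous_on_subset[OF Zc]) (auto simp: Z_def Cg)
    also have "\<dots> \<le> Cg * (t - a)" using that Cg by (intro mult_left_mono) auto
    finally show ?thesis by simp
  qed
  have path: "continuous_on {a..t} (\<lambda>s. radial (X s \<omega>))" if "\<omega> \<in> space (P u)" for \<omega>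
    using a that by (intro continuous_on_radial continuous_on_subset[OF path_continuous]) (auto simp: space_P)
  have Ybd: "\<bar>Y q \<omega>\<bar> \<le> Cf + Cg * (t - a)" if "q \<in> {a..t}" "\<omega> \<in> space (P u)" for q \<omega>
    using Ibd[of a q \<omega>] Cf(2)[of "X q \<omega>"] that unfolding Y_def by (simp add: abs_le_iff)
  have theta: "\<theta> \<omega> \<in> {a..t}" if "\<omega> \<in> space (P u)" for \<omega>
    unfolding \<theta>_def by (rule first_hit_mem[OF path[OF that] a(2)])
  have Ym: "Y q \<in> borel_measurable (P u)" if "q \<in> {a..t}" for q
  proof -
    have "{} \<in> sets (F a)" by simp
    then show ?thesis
      unfolding Y_def using that a Im[of a q "{}"] observable_measurable[OF _ f, of q]
      by (intro borel_measurable_diff) auto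
  qed
  have Yc: "continuous_on {a..t} (\<lambda>q. Y q \<omega>)" if w: "\<omega> \<in> space (P u)" for \<omega>
    unfolding Y_def
  proof (intro continuous_on_diff indefinite_integral_continuous_1 Zi[OF w])
    have "continuous_on {a..t} (\<lambda>q. f (X (max 0 q) \<omega>))"
      using w by (intro continuous_on_subset[OF observable_continuous[OF f]]) (auto simp: space_P)
    then show "continuous_on {a..t} (\<lambda>q. f (X q \<omega>))"
      by (rule continuous_on_eq) (use a in auto)
  qed
  have alive: "{\<omega> \<in> L. q < \<theta> \<omega>} \<in> sets (F q)" if "q \<in> {a..t}" for q
    unfolding \<theta>_def using that a L by (intro first_hit_alive_measurable) auto
  have mart: "(\<integral>\<omega>. (Y q' \<omega> - Y q \<omega>) * indicator {\<omega> \<in> L. q < \<theta> \<omega>} \<omega> \<partial>P u) = 0"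
    if q: "a \<le> q" "q \<le> q'" "q' \<le> t" for q q'
  proof -
    let ?A = "{\<omega> \<in> L. q < \<theta> \<omega>}"
    have A: "?A \<in> sets (F q)" using q by (intro alive) auto
    note [measurable] = L_sub[OF A]
    have int: "integrable (P u) (\<lambda>\<omega>. f (X z \<omega>) * indicator ?A \<omega>)" if "a \<le> z" for z
    proof (rule integrable_bounded)
      show "(\<lambda>\<omega>. f (X z \<omega>) * indicator ?A \<omega>) \<in> borel_measurable (P u)"
        using observable_measurable[OF _ f, of z] that a by (intro borel_measurable_times) auto
    qed (use Cf in \<open>auto split: split_indicator\<close>)
    have intI: "integrable (P u) (\<lambda>\<omega>. integral {q..q'} (\<lambda>s. Z s \<omega>) * indicator ?A \<omega>)"
    proof (rule integrable_bounded)
      show "(\<lambda>\<omega>. integral {q..q'} (\<lambda>s. Z s \<omega>) * indicator ?A \<omega>) \<in> borel_measurable (P u)"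
        using Im[OF q(1,2) A] by (intro borel_measurable_times) auto
      show "\<bar>integral {q..q'} (\<lambda>s. Z s \<omega>) * indicator ?A \<omega>\<bar> \<le> \<bar>Cg * (t - a)\<bar>"
        if "\<omega> \<in> space (P u)" for \<omega>
        using Ibd[OF q that] by (auto split: split_indicator)
    qed
    have "(\<integral>\<omega>. (Y q' \<omega> - Y q \<omega>) * indicator ?A \<omega> \<partial>P u) =
        (\<integral>\<omega>. f (X q' \<omega>) * indicator ?A \<omega> - f (X q \<omega>) * indicator ?A \<omega>
          - integral {q..q'} (\<lambda>s. Z s \<omega>) * indicator ?A \<omega> \<partial>P u)"
    proof (rule Bochner_Integration.integral_cong[OF refl])
      fix \<omega> assume "\<omega> \<in> space (P u)"
      then have "integral {a..q} (\<lambda>s. Z s \<omega>) + integral {q..q'} (\<lambda>s. Z s \<omega>) = integral {a..q'} (\<lambda>s. Z s \<omega>)"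
        using q by (intro Henstock_Kurzweil_Integration.integral_combine Zi) auto
      then show "(Y q' \<omega> - Y q \<omega>) * indicator ?A \<omega> =
        f (X q' \<omega>) * indicator ?A \<omega> - f (X q \<omega>) * indicator ?A \<omega>
          - integral {q..q'} (\<lambda>s. Z s \<omega>) * indicator ?A \<omega>"
        by (simp add: Y_def algebra_simps split: split_indicator)
    qed
    also have "\<dots> = 0"
      using int[of q] int[of q'] intI q increment[OF q(1,2) A] by simp
    finally show ?thesis .
  qed
  have D_eq: "D \<omega> = (Y (\<theta> \<omega>) \<omega> - Y a \<omega>) * indicator L \<omega>" for \<omega>
  proof -
    have "integral {a..\<theta> \<omega>} (\<lambda>s. g (X s \<omega>)) = integral {a..\<theta> \<omega>} (\<lambda>s. Z s \<omega>)"
      by (rule Henstock_Kurzweil_Integration.integral_cong) (use a in \<open>simp add: Z_def\<close>)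
    then show ?thesis by (simp add: D_def Y_def)
  qed
  have alive': "{\<omega> \<in> L. q < \<theta> \<omega>} \<in> sets (P u)" if "q \<in> {a..t}" for q
    by (rule L_sub[OF alive[OF that]])
  note os = optional_stopping_continuous[where N = "P u" and Y = Y and a = a and t = t and \<theta> = \<theta> and L = L
      and C = "Cf + Cg * (t - a)"]
  have os1: "(\<integral>\<omega>. (Y (\<theta> \<omega>) \<omega> - Y a \<omega>) * indicator L \<omega> \<partial>P u) = 0"
    by (rule os(1)) (fact prob a(2) Ym Ybd Yc theta L_sub[OF L] alive' mart)+
  have os2: "(\<lambda>\<omega>. (Y (\<theta> \<omega>) \<omega> - Y a \<omega>) * indicator L \<omega>) \<in> borel_measurable (P u)"
    by (rule os(2)) (fact prob a(2) Ym Ybd Yc theta L_sub[OF L] alive' mart)+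
  show "(\<integral>\<omega>. D \<omega> \<partial>P u) = 0" unfolding D_eq by (rule os1)
  show "integrable (P u) D"
  proof (rule integrable_bounded)
    show "D \<in> borel_measurable (P u)" unfolding D_eq [abs_def] by (rule os2)
    show "\<bar>D \<omega>\<bar> \<le> 2 * (Cf + Cg * (t - a))" if "\<omega> \<in> space (P u)" for \<omega>
      using Ybd[OF theta[OF that] that] Ybd[OF _ that, of a] a
      by (auto simp: D_eq split: split_indicator)
  qed
qed

lemma first_hit_measurable:
  assumes "0 \<le> a" "a \<le> t"
  shows "(\<lambda>\<omega>. first_hit (\<lambda>s. radial (X s \<omega>)) r a t) \<in> borel_measurable (P u)"
  (is "?\<theta> \<in> _")
proof (rule borel_measurableI_greater)
  fix q
  have mem: "?\<theta> \<omega> \<in> {a..t}" if "\<omega> \<in> space (P u)" for \<omega>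
    using assms that
    by (intro first_hit_mem continuous_on_radial continuous_on_subset[OF path_continuous])
      (auto simp: space_P)
  consider "q < a" | "a \<le> q" "q \<le> t" | "t < q" by linarith
  then show "{\<omega> \<in> space (P u). q < ?\<theta> \<omega>} \<in> sets (P u)"
  proof cases
    case 1
    then have "{\<omega> \<in> space (P u). q < ?\<theta> \<omega>} = space (P u)" using mem by fastforce
    then show ?thesis by simp
  next
    case 2
    have "space M \<in> sets (F a)" using sets.top[of "F a"] by (simp add: space_F)
    from sets_F_subset[OF first_hit_alive_measurable[OF assms(1) 2 this, of r]] show ?thesis
      by (simp add: space_P sets_P)
  next
    case 3
    then have "{\<omega> \<in> space (P u). q < ?\<theta> \<omega>} = {}" using mem by fastforce
    then show ?thesis by (simp only: sets.empty_sets)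
  qed
qed

end

section \<open>Exit from the ball\<close>

lemma first_hit_mono:
  assumes "continuous_on {a..t'} y" "a \<le> t" "t \<le> t'"
  shows "first_hit y r a t \<le> first_hit y r a t'"
proof (rule ccontr)
  assume "\<not> ?thesis"
  then have lt: "first_hit y r a t' < first_hit y r a t" by simp
  have c: "continuous_on {a..t} y" using assms by (auto intro: continuous_on_subset)
  have "a \<le> t'" using assms by simp
  note m = first_hit_mem[OF assms(1) this, of r] first_hit_attained[OF assms(1) this, of r]
  show False
    using m lt less_first_hit_iff[OF c assms(2), of "first_hit y r a t'" r] assms(3) by auto
qed

text \<open>Off the sphere at time \<open>0\<close> it is immaterial whether the time \<open>0\<close> itself is admitted, so the exit time
  is the limit of the hitting times capped at \<open>n\<close>.\<close>

lemma exit_time_eq_SUP_first_hit: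
  assumes cont: "continuous_on {0..} (\<lambda>q. X q \<omega>)" and start: "radial (X 0 \<omega>) \<noteq> r"
  shows "exit_time X r \<omega> = (SUP n. ennreal (first_hit (\<lambda>q. radial (X q \<omega>)) r 0 (real n)))"
    (is "_ = (SUP n. ennreal (?\<theta> n))")
proof (rule antisym)
  have c: "continuous_on {0..real n} (\<lambda>q. radial (X q \<omega>))" for n
    by (intro continuous_on_radial continuous_on_subset[OF cont]) auto
  note att = first_hit_attained[OF c, of _ r] and mem = first_hit_mem[OF c, of _ r]
  show "exit_time X r \<omega> \<le> (SUP n. ennreal (?\<theta> n))"
  proof (cases "\<exists>n. radial (X (?\<theta> n) \<omega>) = r")
    case True
    then obtain n where n: "radial (X (?\<theta> n) \<omega>) = r" by blast
    then have "?\<theta> n \<noteq> 0" using start by metis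
    then have "0 < ?\<theta> n" using mem[of n] by simp
    then have "exit_time X r \<omega> \<le> ennreal (?\<theta> n)"
      using n unfolding exit_time_def by (intro Inf_lower) blast
    also have "\<dots> \<le> (SUP n. ennreal (?\<theta> n))" by (rule SUP_upper) simp
    finally show ?thesis .
  next
    case False
    then have "?\<theta> n = real n" for n using att[of n] by auto
    then have "(SUP n. ennreal (?\<theta> n)) = (SUP n. of_nat n)"
      by (simp only: ennreal_of_nat_eq_real_of_nat)
    then show ?thesis by (simp only: ennreal_SUP_of_nat_eq_top top_greatest)
  qed
  show "(SUP n. ennreal (?\<theta> n)) \<le> exit_time X r \<omega>"
    unfolding exit_time_def
  proof (intro SUP_least Inf_greatest)
    fix n x assume "x \<in> {ennreal t |t. 0 < t \<and> radial (X t \<omega>) = r}"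
    then obtain t where t: "x = ennreal t" "0 < t" "radial (X t \<omega>) = r" by blast
    have "?\<theta> n \<le> t"
    proof (cases "t \<le> real n")
      case True
      then show ?thesis using t by (intro first_hit_le[OF c]) auto
    next
      case False
      then show ?thesis using mem[of n] by simp
    qed
    then show "ennreal (?\<theta> n) \<le> x" using t by (simp add: ennreal_leI)
  qed
qed

text \<open>Before the exit time the radius avoids the level \<open>r\<close>, and by the intermediate value theorem it cannot
  change sides without meeting it.\<close>

lemma exit_time_pos_imp_one_side:
  assumes cont: "continuous_on {0..} (\<lambda>q. X q \<omega>)" and pos: "0 < exit_time X r \<omega>"
  shows "\<exists>d>0. (\<forall>q\<in>{0<..d}. radial (X q \<omega>) < r) \<or> (\<forall>q\<in>{0<..d}. r < radial (X q \<omega>))"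
proof -
  from dense[OF pos] obtain z where z: "0 < z" "z < exit_time X r \<omega>" by blast
  then obtain d where d: "z = ennreal d" "0 \<le> d" by (cases z) auto
  with z have "0 < d" by simp
  have ne: "radial (X q \<omega>) \<noteq> r" if "0 < q" "q \<le> d" for q
  proof
    assume "radial (X q \<omega>) = r"
    then have "exit_time X r \<omega> \<le> ennreal q"
      using that unfolding exit_time_def by (intro Inf_lower) blast
    also have "\<dots> \<le> z" using that d by (simp add: ennreal_leI)
    finally show False using z by simp
  qed
  have c: "continuous_on {q..d} (\<lambda>q. radial (X q \<omega>))" if "0 < q" for q
    using that by (intro continuous_on_radial continuous_on_subset[OF cont]) auto
  consider "radial (X d \<omega>) < r" | "r < radial (X d \<omega>)" using ne[of d] \<open>0 < d\<close> by linarith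
  then show ?thesis
  proof cases
    case 1
    have "radial (X q \<omega>) < r" if q: "q \<in> {0<..d}" for q
    proof (rule ccontr)
      assume wrong: "\<not> radial (X q \<omega>) < r"
      have "\<exists>x\<ge>q. x \<le> d \<and> radial (X x \<omega>) = r"
        using q 1 wrong by (intro IVT2'[OF _ _ _ c]) auto
      then obtain x where "q \<le> x" "x \<le> d" "radial (X x \<omega>) = r" by blast
      then show False using ne[of x] q by simp
    qed
    then show ?thesis using \<open>0 < d\<close> by blast
  next
    case 2
    have "r < radial (X q \<omega>)" if q: "q \<in> {0<..d}" for q
    proof (rule ccontr)
      assume wrong: "\<not> r < radial (X q \<omega>)"
      have "\<exists>x\<ge>q. x \<le> d \<and> radial (X x \<omega>) = r"
        using q 2 wrong by (intro IVT'[OF _ _ _ c]) auto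
      then obtain x where "q \<le> x" "x \<le> d" "radial (X x \<omega>) = r" by blast
      then show False using ne[of x] q by simp
    qed
    then show ?thesis using \<open>0 < d\<close> by blast
  qed
qed

context feller_process
begin

lemma radial_path_continuous:
  "\<omega> \<in> space M \<Longrightarrow> S \<subseteq> {0..} \<Longrightarrow> continuous_on S (\<lambda>q. radial (X q \<omega>))"
  by (intro continuous_on_radial continuous_on_subset[OF path_continuous])

text \<open>Dynkin's formula at the capped hitting times \<open>\<theta> n\<close> reads \<open>E[\<theta> n] = f u - E[f(X\<^bsub>\<theta> n\<^esub>)]\<close>, because
  \<open>g = -1\<close> along the path up to \<open>\<theta> n\<close>. As \<open>f \<ge> 0\<close> in the ball, these expectations are at
  most \<open>f u\<close>; by monotone convergence the exit time has finite mean, hence is finite almost surely.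
  Then \<open>f(X\<^bsub>\<theta> n\<^esub>)\<close> tends to the boundary value \<open>0\<close>, and in the limit the mean exit time is \<open>f u\<close>.\<close>

lemma mean_exit_time_from_inside:
  assumes gen: "(f, g) \<in> generator (transition_semigroup P X)"
    and u: "radial u < r"
    and f_nonneg: "\<And>w. radial w \<le> r \<Longrightarrow> 0 \<le> f w"
    and f_bdry: "\<And>w. radial w = r \<Longrightarrow> f w = 0"
    and g: "\<And>w. radial w \<le> r \<Longrightarrow> g w = -1"
  shows "mean_exit_time P X r u = ennreal (f u)"
proof -
  interpret prob_space "P u" by (rule prob)
  have "f \<in> C0" using gen by (auto simp: generator_def)
  then obtain C where C: "0 \<le> C" "\<And>u. \<bar>f u\<bar> \<le> C" using C0_bounded by blast
  define \<theta> where "\<theta> n \<omega> = first_hit (\<lambda>s. radial (X s \<omega>)) r 0 (real n)" for n \<omega>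
  define L where "L = {\<omega> \<in> space M. X 0 \<omega> = u}"
  \<comment> \<open>Restricting to the event \<open>L\<close> of full measure makes the path identities below hold everywhere.\<close>
  have LF: "L \<in> sets (F 0)"
  proof -
    have "L = X 0 -` {u} \<inter> space (F 0)" unfolding L_def space_F by blast
    then show ?thesis using measurable_sets[OF X_F_measurable[of 0 0], of "{u}"] by simp
  qed
  have L[measurable]: "L \<in> sets (P u)" using sets_F_subset[OF LF] by (simp add: sets_P)
  have AE_L: "AE \<omega> in P u. \<omega> \<in> L"
    using start[of u] AE_space by eventually_elim (simp add: L_def space_P)
  have \<theta>_meas[measurable]: "\<theta> n \<in> borel_measurable (P u)" for n
    unfolding \<theta>_def by (rule first_hit_measurable) auto
  have \<theta>_mem: "\<theta> n \<omega> \<in> {0..real n}" if "\<omega> \<in> space M" for n \<omega>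
    unfolding \<theta>_def by (intro first_hit_mem radial_path_continuous that) auto
  have inside: "radial (X s \<omega>) \<le> r" if "\<omega> \<in> L" "s \<in> {0..\<theta> n \<omega>}" for n s \<omega>
    using that u unfolding \<theta>_def
    by (intro first_hit_stays_below[OF radial_path_continuous, where s = s]) (auto simp: L_def)
  define W where "W n \<omega> = f (X (\<theta> n \<omega>) \<omega>) * indicator L \<omega>" for n \<omega>
  define D where "D n \<omega> = (f (X (\<theta> n \<omega>) \<omega>) - integral {0..\<theta> n \<omega>} (\<lambda>s. g (X s \<omega>)) - f (X 0 \<omega>)) * indicator L \<omega>"
    for n \<omega>
  have D_int: "integrable (P u) (D n)" "(\<integral>\<omega>. D n \<omega> \<partial>P u) = 0" for n
    using dynkin_first_hit[OF gen _ _ LF, where t = "real n" and u = u and r = r]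
    unfolding D_def [abs_def] \<theta>_def by auto
  have D_eq: "D n \<omega> = W n \<omega> + (\<theta> n \<omega> - f u) * indicator L \<omega>" if w: "\<omega> \<in> space (P u)" for n \<omega>
  proof (cases "\<omega> \<in> L")
    case True
    have "integral {0..\<theta> n \<omega>} (\<lambda>s. g (X s \<omega>)) = integral {0..\<theta> n \<omega>} (\<lambda>s. -1)"
      using True by (intro Henstock_Kurzweil_Integration.integral_cong g inside) auto
    also have "\<dots> = - \<theta> n \<omega>" using \<theta>_mem[of \<omega> n] w by (simp add: space_P)
    finally show ?thesis using True by (simp add: D_def W_def L_def)
  qed (simp add: D_def W_def)
  have \<theta>_int: "integrable (P u) (\<lambda>\<omega>. \<theta> n \<omega> * indicator L \<omega>)" for n
  proof (rule integrable_bounded)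
    show "\<bar>\<theta> n \<omega> * indicator L \<omega>\<bar> \<le> real n" if "\<omega> \<in> space (P u)" for \<omega>
      using \<theta>_mem[of \<omega> n] that by (auto simp: space_P split: split_indicator)
  qed measurable
  have L_int: "integrable (P u) (\<lambda>\<omega>. f u * indicator L \<omega>)"
    by (rule integrable_bounded[where C = C]) (use C in \<open>auto split: split_indicator\<close>)
  have W_int: "integrable (P u) (W n)"
    and W_val: "(\<integral>\<omega>. \<theta> n \<omega> * indicator L \<omega> \<partial>P u) = f u - (\<integral>\<omega>. W n \<omega> \<partial>P u)" for n
  proof -
    have W_eq: "W n \<omega> = D n \<omega> - \<theta> n \<omega> * indicator L \<omega> + f u * indicator L \<omega>"
      if "\<omega> \<in> space (P u)" for \<omega>
      using D_eq[OF that, of n] by (simp add: algebra_simps)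
    have i: "integrable (P u) (\<lambda>\<omega>. D n \<omega> - \<theta> n \<omega> * indicator L \<omega> + f u * indicator L \<omega>)"
      by (intro Bochner_Integration.integrable_add Bochner_Integration.integrable_diff D_int \<theta>_int L_int)
    then show "integrable (P u) (W n)"
      by (simp cong: Bochner_Integration.integrable_cong add: W_eq)
    have "prob L = 1" using AE_L by (simp add: prob_eq_1)
    then have "(\<integral>\<omega>. f u * indicator L \<omega> \<partial>P u) = f u" by simp
    moreover have "(\<integral>\<omega>. W n \<omega> \<partial>P u)
        = (\<integral>\<omega>. D n \<omega> - \<theta> n \<omega> * indicator L \<omega> + f u * indicator L \<omega> \<partial>P u)"
      by (rule Bochner_Integration.integral_cong[OF refl W_eq])
    moreover have "(\<integral>\<omega>. D n \<omega> - \<theta> n \<omega> * indicator L \<omega> + f u * indicator L \<omega> \<partial>P u)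
        = (\<integral>\<omega>. D n \<omega> \<partial>P u) - (\<integral>\<omega>. \<theta> n \<omega> * indicator L \<omega> \<partial>P u) + (\<integral>\<omega>. f u * indicator L \<omega> \<partial>P u)"
      by (simp only: Bochner_Integration.integral_add Bochner_Integration.integral_diff
          Bochner_Integration.integrable_diff D_int(1) \<theta>_int L_int)
    ultimately show "(\<integral>\<omega>. \<theta> n \<omega> * indicator L \<omega> \<partial>P u) = f u - (\<integral>\<omega>. W n \<omega> \<partial>P u)"
      using D_int(2)[of n] by linarith
  qed
  have W_nonneg: "0 \<le> W n \<omega>" for n \<omega>
  proof (cases "\<omega> \<in> L")
    case True
    then have "\<theta> n \<omega> \<in> {0..\<theta> n \<omega>}" using \<theta>_mem[of \<omega> n] by (simp add: L_def)
    then show ?thesis using f_nonneg[OF inside[OF True]] True by (auto simp: W_def)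
  qed (simp add: W_def)
  have nn: "(\<integral>\<^sup>+\<omega>. ennreal (\<theta> n \<omega> * indicator L \<omega>) \<partial>P u) = ennreal (f u - (\<integral>\<omega>. W n \<omega> \<partial>P u))" for n
  proof -
    have "AE \<omega> in P u. 0 \<le> \<theta> n \<omega> * indicator L \<omega>"
      using \<theta>_mem by (intro AE_I2) (auto simp: space_P)
    then show ?thesis by (simp only: nn_integral_eq_integral[OF \<theta>_int] W_val)
  qed
  define S where "S \<omega> = (SUP n. ennreal (\<theta> n \<omega> * indicator L \<omega>))" for \<omega>
  have \<theta>_mono: "\<theta> n \<omega> \<le> \<theta> m \<omega>" if "\<omega> \<in> space M" "n \<le> m" for n m \<omega>
    unfolding \<theta>_def using that by (intro first_hit_mono radial_path_continuous) auto
  have exit: "exit_time X r \<omega> = S \<omega>" if "\<omega> \<in> L" for \<omega>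
    using that u exit_time_eq_SUP_first_hit[of X \<omega> r] path_continuous[of \<omega>]
    by (simp add: S_def \<theta>_def L_def)
  have "(\<integral>\<^sup>+\<omega>. S \<omega> \<partial>P u) = (SUP n. \<integral>\<^sup>+\<omega>. ennreal (\<theta> n \<omega> * indicator L \<omega>) \<partial>P u)"
    unfolding S_def
  proof (rule nn_integral_monotone_convergence_SUP_AE)
    show "AE \<omega> in P u. ennreal (\<theta> i \<omega> * indicator L \<omega>) \<le> ennreal (\<theta> (Suc i) \<omega> * indicator L \<omega>)" for i
      using \<theta>_mono[of _ i "Suc i"]
      by (intro AE_I2 ennreal_leI) (auto simp: space_P split: split_indicator)
  qed simp
  then have S_val: "(\<integral>\<^sup>+\<omega>. S \<omega> \<partial>P u) = (SUP n. ennreal (f u - (\<integral>\<omega>. W n \<omega> \<partial>P u)))"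
    by (simp only: nn)
  also have "\<dots> \<le> ennreal (f u)"
    using W_nonneg by (intro SUP_least ennreal_leI) (simp add: integral_nonneg_AE)
  finally have S_fin: "(\<integral>\<^sup>+\<omega>. S \<omega> \<partial>P u) \<noteq> \<infinity>" by (auto simp: top_unique)
  have S_meas: "S \<in> borel_measurable (P u)"
    unfolding S_def [abs_def] by measurable
  have AE_fin: "AE \<omega> in P u. S \<omega> \<noteq> \<infinity>"
    by (rule nn_integral_PInf_AE[OF S_meas S_fin])
  have W_lim: "(\<lambda>n. \<integral>\<omega>. W n \<omega> \<partial>P u) \<longlonglongrightarrow> (\<integral>\<omega>. 0 \<partial>P u)"
  proof (rule integral_dominated_convergence[where w = "\<lambda>_. C"])
    show "AE \<omega> in P u. (\<lambda>n. W n \<omega>) \<longlonglongrightarrow> 0"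
      using AE_fin AE_L
    proof eventually_elim
      fix \<omega> assume fin: "S \<omega> \<noteq> \<infinity>" and w: "\<omega> \<in> L"
      then have wM: "\<omega> \<in> space M" by (simp add: L_def)
      obtain x where x: "S \<omega> = ennreal x" "0 \<le> x" using fin by (cases "S \<omega>") auto
      obtain N where N: "x < real N" using reals_Archimedean2 by blast
      have "W n \<omega> = 0" if "N \<le> n" for n
      proof -
        have "ennreal (\<theta> n \<omega> * indicator L \<omega>) \<le> S \<omega>" unfolding S_def by (rule SUP_upper) simp
        then have "\<theta> n \<omega> \<le> x" using w x by simp
        then have "\<theta> n \<omega> < real n" using N that by linarith
        moreover have "\<theta> n \<omega> \<in> {q \<in> {0..real n}. radial (X q \<omega>) = r} \<union> {real n}"
          unfolding \<theta>_def by (intro first_hit_attained radial_path_continuous wM) auto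
        ultimately show ?thesis using f_bdry by (simp add: W_def)
      qed
      then show "(\<lambda>n. W n \<omega>) \<longlonglongrightarrow> 0"
        by (intro tendsto_eventually eventually_sequentiallyI[of N])
    qed
    show "AE \<omega> in P u. norm (W n \<omega>) \<le> C" for n
      using C by (intro AE_I2) (auto simp: W_def split: split_indicator)
    show "W n \<in> borel_measurable (P u)" for n
      using W_int by (rule borel_measurable_integrable)
  qed simp_all
  have lim: "(\<lambda>n. ennreal (f u - (\<integral>\<omega>. W n \<omega> \<partial>P u))) \<longlonglongrightarrow> ennreal (f u)"
    using tendsto_diff[OF tendsto_const W_lim, of "f u"] by (intro tendsto_ennrealI) simp
  have "incseq (\<lambda>n. ennreal (f u - (\<integral>\<omega>. W n \<omega> \<partial>P u)))"
    unfolding nn[symmetric] using \<theta>_mono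
    by (intro incseq_SucI nn_integral_mono ennreal_leI) (auto simp: space_P split: split_indicator)
  from LIMSEQ_unique[OF LIMSEQ_SUP[OF this] lim]
  have "(\<integral>\<^sup>+\<omega>. S \<omega> \<partial>P u) = ennreal (f u)" by (simp only: S_val)
  moreover have "mean_exit_time P X r u = (\<integral>\<^sup>+\<omega>. S \<omega> \<partial>P u)"
    unfolding mean_exit_time_def
    by (rule nn_integral_cong_AE) (use AE_L in \<open>eventually_elim, simp add: exit\<close>)
  ultimately show ?thesis by simp
qed

text \<open>Started on the sphere, the process almost surely does not move off to the side described by \<open>I\<close>
  without returning at once. Let \<open>a \<down> 0\<close>. On the event that \<open>X\<^sub>a\<close> lies on that side, Dynkin's formula
  between \<open>a\<close> and the next hitting time \<open>\<theta>\<close> bounds the expectation of \<open>\<integral>\<^sub>a\<^sup>\<theta> (-g)(X\<^sub>s) ds\<close> by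
  that of \<open>f(X\<^sub>a) - f u\<close>, since \<open>f\<close> is minimal at \<open>u\<close>; this tends to \<open>0\<close>. On a path that
  escapes, however, \<open>\<theta>\<close> stays away from \<open>0\<close>, and the integral of the positive function \<open>-g(X\<^sub>s)\<close>
  stays bounded below by a positive number. Fatou's lemma shows that such paths form a null set.\<close>

lemma no_one_sided_escape:
  assumes gen: "(f, g) \<in> generator (transition_semigroup P X)"
    and u: "radial u = r"
    and I: "I = {..r} \<or> I = {r..}"
    and f_min: "\<And>w. radial w \<in> I \<Longrightarrow> f u \<le> f w"
    and g_neg: "\<And>w. radial w \<in> I \<Longrightarrow> g w < 0"
  shows "AE \<omega> in P u. \<not> (\<exists>d>0. \<forall>q\<in>{0<..d}. radial (X q \<omega>) \<in> I - {r})"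
proof -
  interpret prob_space "P u" by (rule prob)
  have fC: "f \<in> C0" and gC: "g \<in> C0" using gen by (auto simp: generator_def)
  obtain C where C: "0 \<le> C" "\<And>u. \<bar>f u\<bar> \<le> C" by (rule C0_bounded[OF fC]) blast
  define a where "a n = 1 / real (Suc n)" for n
  have a: "0 < a n" "a n \<le> 1" for n by (auto simp: a_def)
  have a_lim: "a \<longlonglongrightarrow> 0" unfolding a_def [abs_def] by (rule LIMSEQ_Suc[OF lim_1_over_n])
  define \<theta> where "\<theta> n \<omega> = first_hit (\<lambda>s. radial (X s \<omega>)) r (a n) 1" for n \<omega>
  define L where "L n = {\<omega> \<in> space M. radial (X (a n) \<omega>) \<in> I}" for n
  have LF: "L n \<in> sets (F (a n))" for n
  proof -
    have "I \<in> sets borel" using I by auto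
    moreover have "(\<lambda>\<omega>. radial (X (a n) \<omega>)) \<in> borel_measurable (F (a n))"
      using a[of n] by (intro measurable_compose[OF X_F_measurable radial_borel]) auto
    ultimately show ?thesis
      using measurable_sets[of "\<lambda>\<omega>. radial (X (a n) \<omega>)" "F (a n)" borel I]
      by (simp add: L_def space_F vimage_def Int_def conj_commute)
  qed
  have L[measurable]: "L n \<in> sets (P u)" for n using sets_F_subset[OF LF] by (simp add: sets_P)
  have c: "continuous_on {a n..1} (\<lambda>q. radial (X q \<omega>))" if "\<omega> \<in> L n" for n \<omega>
    using that a[of n] by (intro radial_path_continuous) (auto simp: L_def)
  have stays: "radial (X s \<omega>) \<in> I" if "\<omega> \<in> L n" "s \<in> {a n..\<theta> n \<omega>}" for n s \<omega>
    using that I first_hit_stays_below[OF c[OF that(1)] a(2), of r s]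
      first_hit_stays_above[OF c[OF that(1)] a(2), of r s]
    by (auto simp: L_def \<theta>_def)
  have \<theta>_mem: "\<theta> n \<omega> \<in> {a n..1}" if "\<omega> \<in> L n" for n \<omega>
    unfolding \<theta>_def by (rule first_hit_mem[OF c[OF that] a(2)])
  have gi: "(\<lambda>s. - g (X s \<omega>)) integrable_on {x..y}" if "\<omega> \<in> space M" "0 \<le> x" for x y \<omega>
  proof -
    have "continuous_on {x..y} (\<lambda>q. g (X (max 0 q) \<omega>))"
      by (rule continuous_on_subset[OF observable_continuous[OF gC that(1)]]) simp
    then have "continuous_on {x..y} (\<lambda>q. g (X q \<omega>))"
      by (rule continuous_on_eq) (use that in auto)
    then show ?thesis by (intro integrable_continuous_real continuous_intros)
  qed
  define D where "D n \<omega> = (f (X (\<theta> n \<omega>) \<omega>) - integral {a n..\<theta> n \<omega>} (\<lambda>s. g (X s \<omega>)) - f (X (a n) \<omega>))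
    * indicator (L n) \<omega>" for n \<omega>
  have D_int: "integrable (P u) (D n)" "(\<integral>\<omega>. D n \<omega> \<partial>P u) = 0" for n
    using dynkin_first_hit[OF gen less_imp_le[OF a(1)] a(2) LF[of n], where u = u and r = r]
    unfolding D_def [abs_def] \<theta>_def by auto
  define B where "B n \<omega> = (f (X (a n) \<omega>) - f u) * indicator (L n) \<omega>" for n \<omega>
  have obs[measurable]: "(\<lambda>\<omega>. f (X (a n) \<omega>)) \<in> borel_measurable (P u)" for n
    using a[of n] by (intro observable_measurable fC) auto
  have bd: "\<bar>f w - f u\<bar> \<le> 2 * C" for w using C(2)[of w] C(2)[of u] by linarith
  have B_int: "integrable (P u) (B n)" for n
  proof (rule integrable_bounded)
    show "\<bar>B n \<omega>\<bar> \<le> 2 * C" for \<omega>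
      using bd C by (auto simp: B_def split: split_indicator)
    show "B n \<in> borel_measurable (P u)" unfolding B_def by measurable
  qed
  \<comment> \<open>\<open>D n\<close> has expectation zero and \<open>B n\<close> tends to zero, so \<open>E[W n]\<close> tends to zero, while \<open>W n\<close> dominates the integral of \<open>-g\<close> on \<open>L n\<close>.\<close>
  define W where "W n \<omega> = D n \<omega> + B n \<omega>" for n \<omega>
  have W_int: "integrable (P u) (W n)" for n
    unfolding W_def using D_int B_int by simp
  have W_eq: "W n \<omega> = (f (X (\<theta> n \<omega>) \<omega>) - f u + integral {a n..\<theta> n \<omega>} (\<lambda>s. - g (X s \<omega>))) * indicator (L n) \<omega>"
    for n \<omega>
    by (simp add: W_def D_def B_def algebra_simps)
  have W_ge: "integral {x..y} (\<lambda>s. - g (X s \<omega>)) \<le> W n \<omega>"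
    if "\<omega> \<in> L n" "a n \<le> x" "y \<le> \<theta> n \<omega>" for n x y \<omega>
  proof -
    have w: "\<omega> \<in> space M" using that by (simp add: L_def)
    have "integral {x..y} (\<lambda>s. - g (X s \<omega>)) \<le> integral {a n..\<theta> n \<omega>} (\<lambda>s. - g (X s \<omega>))"
    proof (rule integral_subset_le)
      show "\<forall>s\<in>{a n..\<theta> n \<omega>}. 0 \<le> - g (X s \<omega>)"
        using g_neg[OF stays[OF that(1)]] by (auto intro: less_imp_le)
    qed (use that a[of n] w in \<open>auto intro!: gi less_imp_le\<close>)
    moreover have "f u \<le> f (X (\<theta> n \<omega>) \<omega>)"
      using \<theta>_mem[OF that(1)] by (intro f_min stays[OF that(1)]) auto
    ultimately show ?thesis using that by (simp add: W_eq)
  qed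
  have W_nonneg: "0 \<le> W n \<omega>" for n \<omega>
  proof (cases "\<omega> \<in> L n")
    case True
    from W_ge[OF this, of "a n" "a n"] \<theta>_mem[OF this] show ?thesis by simp
  qed (simp add: W_eq)
  have "(\<lambda>n. \<integral>\<omega>. B n \<omega> \<partial>P u) \<longlonglongrightarrow> (\<integral>\<omega>. 0 \<partial>P u)"
  proof (rule integral_dominated_convergence[where w = "\<lambda>_. 2 * C"])
    show "AE \<omega> in P u. (\<lambda>n. B n \<omega>) \<longlonglongrightarrow> 0"
      using start[of u] AE_space
    proof eventually_elim
      fix \<omega> assume X0: "X 0 \<omega> = u" and "\<omega> \<in> space (P u)"
      then have "continuous_on UNIV (\<lambda>q. f (X (max 0 q) \<omega>))"
        by (intro observable_continuous[OF fC]) (simp add: space_P)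
      then have "(\<lambda>n. f (X (max 0 (a n)) \<omega>)) \<longlonglongrightarrow> f (X (max 0 0) \<omega>)"
        using a_lim by (intro continuous_on_tendsto_compose[where f = "\<lambda>q. f (X (max 0 q) \<omega>)"]) auto
      moreover have "max 0 (a n) = a n" for n using a[of n] by simp
      ultimately have "(\<lambda>n. f (X (a n) \<omega>)) \<longlonglongrightarrow> f u" using X0 by simp
      then have 0: "(\<lambda>n. f (X (a n) \<omega>) - f u) \<longlonglongrightarrow> 0" by (rule LIM_zero)
      show "(\<lambda>n. B n \<omega>) \<longlonglongrightarrow> 0"
        by (rule tendsto_rabs_zero_cancel, rule tendsto_sandwich[OF _ _ tendsto_const tendsto_rabs_zero[OF 0]])
          (auto simp: B_def split: split_indicator)
    qed
    show "AE \<omega> in P u. norm (B n \<omega>) \<le> 2 * C" for n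
      using bd C by (intro AE_I2) (auto simp: B_def split: split_indicator)
    show "B n \<in> borel_measurable (P u)" for n using B_int by (rule borel_measurable_integrable)
  qed simp_all
  moreover have "(\<integral>\<omega>. W n \<omega> \<partial>P u) = (\<integral>\<omega>. B n \<omega> \<partial>P u)" for n
    unfolding W_def using D_int B_int by simp
  ultimately have "(\<lambda>n. ennreal (\<integral>\<omega>. W n \<omega> \<partial>P u)) \<longlonglongrightarrow> ennreal 0"
    by (intro tendsto_ennrealI) simp
  moreover have "(\<integral>\<^sup>+\<omega>. ennreal (W n \<omega>) \<partial>P u) = ennreal (\<integral>\<omega>. W n \<omega> \<partial>P u)" for n
    using W_nonneg by (intro nn_integral_eq_integral W_int) simp
  ultimately have "liminf (\<lambda>n. \<integral>\<^sup>+\<omega>. ennreal (W n \<omega>) \<partial>P u) = 0"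
    by (intro lim_imp_Liminf) simp_all
  moreover have Wm: "(\<lambda>\<omega>. ennreal (W n \<omega>)) \<in> borel_measurable (P u)" for n
    using borel_measurable_integrable[OF W_int] by measurable
  ultimately have "(\<integral>\<^sup>+\<omega>. liminf (\<lambda>n. ennreal (W n \<omega>)) \<partial>P u) = 0"
    using nn_integral_liminf[of "\<lambda>n \<omega>. ennreal (W n \<omega>)" "P u"] by simp
  then have "AE \<omega> in P u. liminf (\<lambda>n. ennreal (W n \<omega>)) = 0"
    by (subst (asm) nn_integral_0_iff_AE) (auto intro: borel_measurable_liminf Wm)
  then show ?thesis
    using AE_space
  proof eventually_elim
    fix \<omega> assume lim0: "liminf (\<lambda>n. ennreal (W n \<omega>)) = 0" and w: "\<omega> \<in> space (P u)"
    show "\<not> (\<exists>d>0. \<forall>q\<in>{0<..d}. radial (X q \<omega>) \<in> I - {r})"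
    proof
      assume "\<exists>d>0. \<forall>q\<in>{0<..d}. radial (X q \<omega>) \<in> I - {r}"
      then obtain d' where d': "0 < d'" "\<forall>q\<in>{0<..d'}. radial (X q \<omega>) \<in> I - {r}" by blast
      define d where "d = min d' (1/2)"
      have d: "0 < d" "d < 1" "\<And>q. 0 < q \<Longrightarrow> q \<le> d \<Longrightarrow> radial (X q \<omega>) \<in> I - {r}"
        using d' by (auto simp: d_def)
      have wM: "\<omega> \<in> space M" using w by (simp add: space_P)
      let ?k = "integral {d/2..d} (\<lambda>s. - g (X s \<omega>))"
      have "continuous_on {d/2..d} (\<lambda>q. g (X (max 0 q) \<omega>))"
        by (rule continuous_on_subset[OF observable_continuous[OF gC wM]]) simp
      then have "continuous_on {d/2..d} (\<lambda>q. g (X q \<omega>))"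
        by (rule continuous_on_eq) (use d in auto)
      then have "\<exists>s\<in>{d/2..d}. \<forall>s'\<in>{d/2..d}. - g (X s \<omega>) \<le> - g (X s' \<omega>)"
        using d by (intro continuous_attains_inf continuous_intros) auto
      then obtain s where s: "s \<in> {d/2..d}" "\<And>s'. s' \<in> {d/2..d} \<Longrightarrow> - g (X s \<omega>) \<le> - g (X s' \<omega>)"
        by blast
      have "0 < (d/2) * - g (X s \<omega>)"
        using g_neg[of "X s \<omega>"] d(3)[of s] s(1) d(1) by (intro mult_pos_pos) auto
      also have "\<dots> = integral {d/2..d} (\<lambda>_. - g (X s \<omega>))" using d by (simp add: field_simps)
      also have "\<dots> \<le> ?k"
        using d s(2) wM by (intro integral_le gi) auto
      finally have k: "0 < ?k" .
      have "\<forall>\<^sub>F n in sequentially. a n < d / 2"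
        using d by (intro order_tendstoD[OF a_lim]) auto
      then have "\<forall>\<^sub>F n in sequentially. ennreal ?k \<le> ennreal (W n \<omega>)"
      proof eventually_elim
        fix n assume n: "a n < d / 2"
        have wL: "\<omega> \<in> L n" using d(3)[of "a n"] a[of n] n d(1) wM by (auto simp: L_def)
        have "d < \<theta> n \<omega>"
          unfolding \<theta>_def using d a[of n] n
          by (subst less_first_hit_iff[OF c[OF wL] a(2)]) auto
        then show "ennreal ?k \<le> ennreal (W n \<omega>)"
          using n by (intro ennreal_leI W_ge[OF wL]) auto
      qed
      then have "ennreal ?k \<le> liminf (\<lambda>n. ennreal (W n \<omega>))" by (rule Liminf_bounded)
      then show False using k lim0 by simp
    qed
  qed
qed

end

section \<open>Radial functions in the domain of the generator\<close>

text \<open>Ray derivatives of a function that is given near the vertex by one profile \<open>\<phi>\<close> of the radius,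
  whatever its values at radius \<open>R\<close> and beyond. With \<open>R = \<infinity>\<close> this concerns the test functions in the
  domain of the generator, with \<open>R = r\<close> the mean exit time.\<close>

context
  fixes R :: ereal and f :: "'n star \<Rightarrow> real" and \<phi> \<phi>' \<phi>'' :: "real \<Rightarrow> real"
  assumes R: "0 < R"
    and profile: "\<And>j x. 0 < x \<Longrightarrow> ereal x < R \<Longrightarrow> f (pt j x) = \<phi> x"
    and d1: "\<And>x. 0 < x \<Longrightarrow> ereal x < R \<Longrightarrow> (\<phi> has_real_derivative \<phi>' x) (at x)"
    and d2: "\<And>x. 0 < x \<Longrightarrow> ereal x < R \<Longrightarrow> (\<phi>' has_real_derivative \<phi>'' x) (at x)"
begin

lemma open_profile_domain: "open {x. 0 < x \<and> ereal x < R}"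
proof -
  have "{x. 0 < x \<and> ereal x < R} = {0<..} \<inter> ereal -` {..<R}" by auto
  moreover have "open (ereal -` {..<R})"
    by (intro open_vimage continuous_on_ereal continuous_on_id) simp
  ultimately show ?thesis by (simp add: open_Int)
qed

lemma eventually_profile_domain: "\<forall>\<^sub>F x in at_right 0. 0 < x \<and> ereal x < R"
proof -
  obtain \<rho> where \<rho>: "0 < ereal \<rho>" "ereal \<rho> < R" using ereal_dense2[OF R] by blast
  have "\<forall>\<^sub>F x in at_right 0. x \<in> {0<..<\<rho>}"
    using \<rho> by (intro eventually_at_right_real) simp
  then show ?thesis
  proof eventually_elim
    fix x assume x: "x \<in> {0<..<\<rho>}"
    then have "ereal x < ereal \<rho>" by simp
    with \<rho> have "ereal x < R" by (meson less_trans)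
    with x show "0 < x \<and> ereal x < R" by simp
  qed
qed

lemma on_ray_has_derivative:
  assumes "0 < x" "ereal x < R"
  shows "(on_ray f j has_real_derivative \<phi>' x) (at x)"
  by (rule has_field_derivative_transform_within_open[OF d1[OF assms] open_profile_domain])
    (use assms profile in \<open>auto simp: on_ray_def\<close>)

lemma on_ray'_eq: "0 < x \<Longrightarrow> ereal x < R \<Longrightarrow> on_ray' f j x = \<phi>' x"
  unfolding on_ray'_def by (rule DERIV_imp_deriv[OF on_ray_has_derivative])

lemma on_ray'_has_derivative:
  assumes "0 < x" "ereal x < R"
  shows "(on_ray' f j has_real_derivative \<phi>'' x) (at x)"
  by (rule has_field_derivative_transform_within_open[OF d2[OF assms] open_profile_domain])
    (use assms on_ray'_eq in auto)

lemma on_ray''_eq: "0 < x \<Longrightarrow> ereal x < R \<Longrightarrow> on_ray'' f j x = \<phi>'' x"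
  using DERIV_imp_deriv[OF on_ray'_has_derivative] by (simp add: on_ray''_def on_ray'_def)

lemma C2_on_rays_radial:
  assumes "continuous_on {x. 0 < x \<and> ereal x < R} \<phi>''"
  shows "C2_on_rays R f"
  unfolding C2_on_rays_def field_differentiable_def
proof (intro allI conjI impI)
  show "continuous_on {x. 0 < x \<and> ereal x < R} (on_ray'' f j)" for j
    using assms by (rule continuous_on_eq) (simp add: on_ray''_eq)
qed (use on_ray_has_derivative on_ray'_has_derivative in blast)+

lemma on_ray''_tendsto: "(\<phi>'' \<longlongrightarrow> l) (at_right 0) \<Longrightarrow> (on_ray'' f j \<longlongrightarrow> l) (at_right 0)"
  by (rule Lim_transform_eventually, assumption)
    (use eventually_profile_domain in \<open>eventually_elim, simp add: on_ray''_eq\<close>)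

lemma on_ray'_tendsto: "(\<phi>' \<longlongrightarrow> l) (at_right 0) \<Longrightarrow> (on_ray' f j \<longlongrightarrow> l) (at_right 0)"
  by (rule Lim_transform_eventually, assumption)
    (use eventually_profile_domain in \<open>eventually_elim, simp add: on_ray'_eq\<close>)

lemma A_op_radial:
  assumes "(\<phi>'' \<longlongrightarrow> \<phi>'' 0) (at_right 0)" "ereal (radial u) < R"
  shows "A_op f u = \<phi>'' (radial u)"
proof -
  obtain j x where x: "0 \<le> x" "u = pt j x" "radial u = x" by (rule pt_radial_cases)
  show ?thesis
  proof (cases "x = 0")
    case True
    then show ?thesis using x A_op_vertex[OF on_ray''_tendsto[OF assms(1)], of j] by simp
  next
    case False
    then show ?thesis using x assms(2) by (simp add: A_op_pt on_ray''_eq)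
  qed
qed

end

text \<open>For a radial function all ray derivatives at the vertex agree, so the weights only enter through
  their sum.\<close>

lemma vertex_condition_radial:
  fixes f :: "'n::finite star \<Rightarrow> real"
  assumes "0 < R"
    and "\<And>j x. 0 < x \<Longrightarrow> ereal x < R \<Longrightarrow> f (pt j x) = \<phi> x"
    and "\<And>x. 0 < x \<Longrightarrow> ereal x < R \<Longrightarrow> (\<phi> has_real_derivative \<phi>' x) (at x)"
    and "\<And>x. 0 < x \<Longrightarrow> ereal x < R \<Longrightarrow> (\<phi>' has_real_derivative \<phi>'' x) (at x)"
    and "(\<phi>' \<longlongrightarrow> d) (at_right 0)" "(\<phi>'' \<longlongrightarrow> l) (at_right 0)"
    and "(\<Sum>k\<in>UNIV. p k) = 1" "c / 2 * l = b * d"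
  shows "vertex_condition p b c f"
  unfolding vertex_condition_def
proof (intro exI[of _ l] exI[of _ "\<lambda>_. d"] conjI allI)
  show "1 / 2 * c * l = b * (\<Sum>k\<in>UNIV. p k * d)"
    using assms(7,8) by (simp add: sum_distrib_right[symmetric])
qed (use on_ray''_tendsto[OF assms(1-4,6)] on_ray'_tendsto[OF assms(1-5)] in auto)

lemma C0_radial:
  assumes "continuous_on {0..} \<phi>" "(\<phi> \<longlongrightarrow> 0) at_top"
  shows "(\<lambda>u :: 'n star. \<phi> (radial u)) \<in> C0"
proof -
  have "continuous_on UNIV (\<lambda>u :: 'n star. \<phi> (radial u))"
    by (rule continuous_on_compose2[OF assms(1) continuous_on_radial[OF continuous_on_id]]) auto
  moreover have "((\<lambda>u :: 'n star. \<phi> (radial u)) \<longlongrightarrow> 0) (filtercomap radial at_top)"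
    by (rule filterlim_compose[OF assms(2) filterlim_filtercomap])
  ultimately show ?thesis by (simp add: C0_def)
qed

lemma radial_in_A_dom:
  fixes p :: "'n::finite \<Rightarrow> real"
  assumes d1: "\<And>x. (\<phi> has_real_derivative \<phi>' x) (at x)"
    and d2: "\<And>x. (\<phi>' has_real_derivative \<phi>'' x) (at x)"
    and cont: "continuous_on UNIV \<phi>''"
    and lim: "(\<phi> \<longlongrightarrow> 0) at_top" "(\<phi>'' \<longlongrightarrow> 0) at_top"
    and vertex: "c / 2 * \<phi>'' 0 = b * \<phi>' 0" and p: "(\<Sum>k\<in>UNIV. p k) = 1"
  shows "(\<lambda>u. \<phi> (radial u)) \<in> A_dom p b c"
    and "A_op (\<lambda>u :: 'n star. \<phi> (radial u)) = (\<lambda>u. \<phi>'' (radial u))"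
proof -
  let ?f = "\<lambda>u :: 'n star. \<phi> (radial u)"
  have f: "?f (pt j x) = \<phi> x" if "0 < x" "ereal x < \<infinity>" for j x using that by simp
  have c\<phi>: "continuous_on S \<phi>" and c\<phi>': "continuous_on S \<phi>'" for S
    using d1 d2 by (auto intro!: continuous_at_imp_continuous_on DERIV_isCont)
  have t': "(\<phi>' \<longlongrightarrow> \<phi>' 0) (at_right 0)" and t'': "(\<phi>'' \<longlongrightarrow> \<phi>'' 0) (at_right 0)"
    using c\<phi>'[of UNIV] cont
    by (auto simp: continuous_on_eq_continuous_at isCont_def intro: filterlim_mono at_within_le_at)
  have inf: "0 < (\<infinity> :: ereal)" by simp
  show "A_op ?f = (\<lambda>u. \<phi>'' (radial u))"
    using A_op_radial[OF inf f d1 d2 t''] by (intro ext) simp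
  have "?f \<in> C0" by (rule C0_radial[OF c\<phi> lim(1)])
  moreover have "C2_on_rays \<infinity> ?f"
    by (rule C2_on_rays_radial[OF inf f d1 d2 continuous_on_subset[OF cont]]) auto
  moreover have "(\<lambda>u :: 'n star. \<phi>'' (radial u)) \<in> C0"
    by (rule C0_radial[OF continuous_on_subset[OF cont] lim(2)]) simp
  then have "\<exists>g\<in>C0. \<forall>j. \<forall>x>0. g (pt j x) = on_ray'' ?f j x"
    by (rule bexI[rotated]) (simp add: on_ray''_eq[OF inf f d1 d2])
  moreover have "vertex_condition p b c ?f"
    by (rule vertex_condition_radial[OF inf f d1 d2 t' t'' p vertex])
  ultimately show "?f \<in> A_dom p b c" by (simp add: A_dom_def C0_2_def)
qed

lemma sticky_generator_radial:
  fixes p :: "'n::finite \<Rightarrow> real" and P :: "'n star \<Rightarrow> 'w measure"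
  assumes sbm: "sticky_brownian_motion p b c M P X"
    and d1: "\<And>x. (\<phi> has_real_derivative \<phi>' x) (at x)"
    and d2: "\<And>x. (\<phi>' has_real_derivative \<phi>'' x) (at x)"
    and cont: "continuous_on UNIV \<phi>''"
    and lim: "(\<phi> \<longlongrightarrow> 0) at_top" "(\<phi>'' \<longlongrightarrow> 0) at_top"
    and vertex: "c / 2 * \<phi>'' 0 = b * \<phi>' 0" and p: "(\<Sum>k\<in>UNIV. p k) = 1"
  shows "(\<lambda>u. \<phi> (radial u), \<lambda>u. \<phi>'' (radial u) / 2) \<in> generator (transition_semigroup P X)"
proof -
  note A = radial_in_A_dom[OF d1 d2 cont lim vertex p]
  have "generator (transition_semigroup P X) = {(f, \<lambda>u. 1 / 2 * A_op f u) | f. f \<in> A_dom p b c}"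
    using sbm by (simp add: sticky_brownian_motion_def)
  moreover have "(\<lambda>u :: 'n star. \<phi>'' (radial u) / 2) = (\<lambda>u. 1 / 2 * A_op (\<lambda>u. \<phi> (radial u)) u)"
    by (simp add: A(2))
  ultimately show ?thesis using A(1) by blast
qed

text \<open>Applied twice, this shows that the cube of \<open>max 0 (x - r)\<close> is twice continuously differentiable; it
  serves to modify a profile beyond radius \<open>r\<close> only.\<close>

lemma DERIV_pos_part_power:
  fixes r x :: real
  assumes n: "0 < n"
  shows "((\<lambda>x. max 0 (x - r) ^ Suc n) has_real_derivative real (Suc n) * max 0 (x - r) ^ n) (at x)"
proof -
  consider "x < r" | "r < x" | "x = r" by linarith
  then show ?thesis
  proof cases
    case 1
    have "((\<lambda>x. max 0 (x - r) ^ Suc n) has_real_derivative 0) (at x)"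
      by (rule has_field_derivative_transform_within_open[where S = "{..<r}" and f = "\<lambda>_. 0"])
        (use 1 in \<open>auto simp: max_def\<close>)
    moreover have "max 0 (x - r) = 0" using 1 by simp
    ultimately show ?thesis using n by (simp add: power_0_left del: power_Suc)
  next
    case 2
    have "((\<lambda>x. max 0 (x - r) ^ Suc n) has_real_derivative real (Suc n) * (x - r) ^ n) (at x)"
    proof (rule has_field_derivative_transform_within_open[where S = "{r<..}" and f = "\<lambda>x. (x - r) ^ Suc n"])
      show "((\<lambda>x. (x - r) ^ Suc n) has_real_derivative real (Suc n) * (x - r) ^ n) (at x)"
      proof -
        have "((\<lambda>x. x - r) has_real_derivative 1) (at x)" by (auto intro!: derivative_eq_intros)
        from DERIV_power[OF this, of "Suc n"] show ?thesis by (simp del: power_Suc)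
      qed
    qed (use 2 in auto)
    then show ?thesis using 2 by simp
  next
    case 3
    have "((\<lambda>y. (max 0 (y - r) ^ Suc n - max 0 (r - r) ^ Suc n) / (y - r)) \<longlongrightarrow> 0) (at r)"
    proof (rule Lim_null_comparison)
      show "\<forall>\<^sub>F y in at r. norm ((max 0 (y - r) ^ Suc n - max 0 (r - r) ^ Suc n) / (y - r)) \<le> \<bar>y - r\<bar> ^ n"
        by (rule always_eventually) (auto simp: max_def power_abs)
      show "((\<lambda>y. \<bar>y - r\<bar> ^ n) \<longlongrightarrow> 0) (at r)"
        by (rule tendsto_eq_intros refl | simp add: n)+
    qed
    then show ?thesis using 3 n by (simp add: has_field_derivative_iff power_0_left)
  qed
qed

text \<open>The solution of \<open>\<phi>'' = -2\<close> with \<open>\<phi> r = 0\<close> and \<open>\<phi>' 0 = -\<kappa>\<close>. As \<open>\<phi>'' 0 = -2\<close>, the vertex condition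
  is \<open>c = b \<kappa>\<close>.\<close>

definition exit_profile :: "real \<Rightarrow> real \<Rightarrow> real \<Rightarrow> real" where
  "exit_profile r \<kappa> x = r\<^sup>2 - x\<^sup>2 + \<kappa> * (r - x)"

text \<open>The exit profile satisfies the vertex condition but does not vanish at infinity. Multiplying it by
  \<open>exp (- (max 0 (x - r))\<^sup>3)\<close> repairs this without changing it up to radius \<open>r\<close> and without
  losing the second derivative at \<open>r\<close>.\<close>

lemma exit_profile_generator:
  fixes p :: "'n::finite \<Rightarrow> real" and P :: "'n star \<Rightarrow> 'w measure"
  assumes sbm: "sticky_brownian_motion p b c M P X"
    and p: "(\<Sum>k\<in>UNIV. p k) = 1" and b: "0 < b" and r: "0 < r"
  obtains f g where "(f, g) \<in> generator (transition_semigroup P X)"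
    and "\<And>u. radial u \<le> r \<Longrightarrow> f u = exit_profile r (c / b) (radial u)"
    and "\<And>u. radial u \<le> r \<Longrightarrow> g u = -1"
proof -
  define \<kappa> where "\<kappa> = c / b"
  define m where "m x = max 0 (x - r)" for x
  define E where "E x = exp (- (m x ^ 3))" for x
  define h where "h x = exit_profile r \<kappa> x" for x
  define h' where "h' x = - 2 * x - \<kappa>" for x
  define \<phi> where "\<phi> x = h x * E x" for x
  define \<phi>' where "\<phi>' x = (h' x - 3 * m x ^ 2 * h x) * E x" for x
  define \<phi>'' where "\<phi>'' x = (- 2 - 6 * m x ^ 2 * h' x + (9 * m x ^ 4 - 6 * m x) * h x) * E x" for x
  have m2: "((\<lambda>x. m x ^ 2) has_real_derivative 2 * m x) (at x)" for x
    using DERIV_pos_part_power[of 1 r x] by (simp add: m_def numeral_2_eq_2)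
  have m3: "((\<lambda>x. m x ^ 3) has_real_derivative 3 * m x ^ 2) (at x)" for x
    using DERIV_pos_part_power[of 2 r x] by (simp add: m_def numeral_3_eq_3)
  have E: "(E has_real_derivative - 3 * m x ^ 2 * E x) (at x)" for x
    unfolding E_def [abs_def] by (rule derivative_eq_intros m3 refl | simp)+
  have dh: "(h has_real_derivative h' x) (at x)" for x
    unfolding h_def [abs_def] exit_profile_def h'_def by (auto intro!: derivative_eq_intros)
  have dh': "(h' has_real_derivative - 2) (at x)" for x
    unfolding h'_def [abs_def] by (auto intro!: derivative_eq_intros)
  have d1: "(\<phi> has_real_derivative \<phi>' x) (at x)" for x
    unfolding \<phi>_def [abs_def] \<phi>'_def
    by (rule derivative_eq_intros dh E refl | simp add: algebra_simps)+
  have d2: "(\<phi>' has_real_derivative \<phi>'' x) (at x)" for x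
    unfolding \<phi>'_def [abs_def] \<phi>''_def
    by (rule derivative_eq_intros dh dh' m2 E refl | simp add: algebra_simps power2_eq_square power4_eq_xxxx)+
  have cont: "continuous_on UNIV \<phi>''"
    unfolding \<phi>''_def [abs_def] h_def h'_def exit_profile_def E_def m_def
    by (intro continuous_intros)
  have ev: "\<forall>\<^sub>F x in at_top. m x = x - r"
    using eventually_ge_at_top[of r] by eventually_elim (simp add: m_def)
  have "((\<lambda>x. (r\<^sup>2 - x\<^sup>2 + \<kappa> * (r - x)) * exp (- ((x - r) ^ 3))) \<longlongrightarrow> 0) at_top"
    by real_asymp
  then have lim: "(\<phi> \<longlongrightarrow> 0) at_top"
    by (rule Lim_transform_eventually)
      (use ev in \<open>eventually_elim, simp add: \<phi>_def h_def exit_profile_def E_def\<close>)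
  have "((\<lambda>x. (- 2 - 6 * (x - r) ^ 2 * (- 2 * x - \<kappa>) + (9 * (x - r) ^ 4 - 6 * (x - r)) *
      (r\<^sup>2 - x\<^sup>2 + \<kappa> * (r - x))) * exp (- ((x - r) ^ 3))) \<longlongrightarrow> 0) at_top"
    by real_asymp
  then have lim'': "(\<phi>'' \<longlongrightarrow> 0) at_top"
    by (rule Lim_transform_eventually)
      (use ev in \<open>eventually_elim, simp add: \<phi>''_def h_def h'_def exit_profile_def E_def\<close>)
  have vertex: "c / 2 * \<phi>'' 0 = b * \<phi>' 0"
    using b r by (simp add: \<phi>''_def \<phi>'_def m_def E_def h'_def \<kappa>_def max_def)
  show thesis
  proof (rule that)
    show "(\<lambda>u. \<phi> (radial u), \<lambda>u. \<phi>'' (radial u) / 2) \<in> generator (transition_semigroup P X)"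
      by (rule sticky_generator_radial[OF sbm d1 d2 cont lim lim'' vertex p])
  qed (auto simp: \<phi>_def \<phi>''_def m_def E_def h_def \<kappa>_def max_def)
qed

text \<open>The test function that excludes escape to the outside is \<open>-x\<^sup>3 exp(-k x)\<close> in the radius. Its first two
  derivatives vanish at the vertex, so the vertex condition is trivial; it decays at infinity; and for
  \<open>k x \<ge> 6\<close> it is increasing and strictly concave, the second derivative being
  \<open>-x ((k x)\<^sup>2 - 6 k x + 6) exp(-k x)\<close>. The choice \<open>k = 6 / r\<close> makes this range start at \<open>r\<close>.\<close>

lemma concave_outside_generator:
  fixes p :: "'n::finite \<Rightarrow> real" and P :: "'n star \<Rightarrow> 'w measure"
  assumes sbm: "sticky_brownian_motion p b c M P X"
    and p: "(\<Sum>k\<in>UNIV. p k) = 1" and r: "0 < r"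
  obtains f g where "(f, g) \<in> generator (transition_semigroup P X)"
    and "\<And>u w. radial u = r \<Longrightarrow> r \<le> radial w \<Longrightarrow> f u \<le> f w"
    and "\<And>w. r \<le> radial w \<Longrightarrow> g w < 0"
proof -
  define k where "k = 6 / r"
  have k: "0 < k" using r by (simp add: k_def)
  define \<phi> where "\<phi> x = - (x ^ 3 * exp (- k * x))" for x
  define \<phi>' where "\<phi>' x = x ^ 2 * (k * x - 3) * exp (- k * x)" for x
  define \<phi>'' where "\<phi>'' x = - (x * ((k * x)\<^sup>2 - 6 * (k * x) + 6) * exp (- k * x))" for x
  have d1: "(\<phi> has_real_derivative \<phi>' x) (at x)" for x
    unfolding \<phi>_def [abs_def] \<phi>'_def
    by (rule derivative_eq_intros refl | simp add: algebra_simps power2_eq_square power3_eq_cube)+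
  have d2: "(\<phi>' has_real_derivative \<phi>'' x) (at x)" for x
    unfolding \<phi>'_def [abs_def] \<phi>''_def
    by (rule derivative_eq_intros refl | simp add: algebra_simps power2_eq_square power3_eq_cube)+
  have cont: "continuous_on UNIV \<phi>''"
    unfolding \<phi>''_def [abs_def] by (intro continuous_intros)
  have lim: "(\<phi> \<longlongrightarrow> 0) at_top" and lim'': "(\<phi>'' \<longlongrightarrow> 0) at_top"
    unfolding \<phi>_def [abs_def] \<phi>''_def [abs_def] using k by real_asymp+
  have vertex: "c / 2 * \<phi>'' 0 = b * \<phi>' 0" by (simp add: \<phi>''_def \<phi>'_def)
  have kx: "6 \<le> k * x" if "r \<le> x" for x
    using that r by (simp add: k_def field_simps)
  show thesis
  proof (rule that)
    show "(\<lambda>u. \<phi> (radial u), \<lambda>u. \<phi>'' (radial u) / 2) \<in> generator (transition_semigroup P X)"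
      by (rule sticky_generator_radial[OF sbm d1 d2 cont lim lim'' vertex p])
    show "\<phi> (radial u) \<le> \<phi> (radial w)" if "radial u = r" "r \<le> radial w" for u w :: "'n star"
    proof (rule DERIV_nonneg_imp_nondecreasing[where f = \<phi>])
      fix x assume "radial u \<le> x"
      then have "0 \<le> \<phi>' x" using kx[of x] that by (simp add: \<phi>'_def)
      then show "\<exists>y. (\<phi> has_real_derivative y) (at x) \<and> 0 \<le> y" using d1 by blast
    qed (use that in simp)
    show "\<phi>'' (radial w) / 2 < 0" if w: "r \<le> radial w" for w :: "'n star"
    proof -
      let ?y = "k * radial w"
      have "0 \<le> ?y * (?y - 6)" using mult_nonneg_nonneg[of ?y "?y - 6"] kx[OF w] by linarith
      then have "0 < ?y\<^sup>2 - 6 * ?y + 6" by (simp add: power2_eq_square algebra_simps)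
      moreover have "0 < radial w" using r w by simp
      ultimately show ?thesis by (simp add: \<phi>''_def)
    qed
  qed
qed

section \<open>The Poisson problem\<close>

lemma exit_profile_nonneg: "0 < \<kappa> \<Longrightarrow> 0 \<le> x \<Longrightarrow> x \<le> r \<Longrightarrow> 0 \<le> exit_profile r \<kappa> x"
  using power_mono[of x r 2] by (simp add: exit_profile_def)

text \<open>Inside the ball this is Dynkin's formula for the exit profile. On the sphere the profile vanishes, and
  it has to be shown that the process, which is required to be there at a strictly positive time,
  returns immediately: the exit profile excludes an escape to the inside, the outer test
  function one to the outside.\<close>

lemma mean_exit_time_sticky:
  fixes p :: "'n::finite \<Rightarrow> real" and P :: "'n star \<Rightarrow> 'w measure"
  assumes sbm: "sticky_brownian_motion p b c M P X"
    and p: "(\<Sum>k\<in>UNIV. p k) = 1" and b: "0 < b" and c: "0 < c" and r: "0 < r"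
    and u: "radial u \<le> r"
  shows "mean_exit_time P X r u = ennreal (exit_profile r (c / b) (radial u))"
proof -
  interpret feller_process M P X
    using sbm by unfold_locales (auto simp: sticky_brownian_motion_def)
  obtain f g where fg: "(f, g) \<in> generator (transition_semigroup P X)"
    and f: "\<And>u. radial u \<le> r \<Longrightarrow> f u = exit_profile r (c / b) (radial u)"
    and g: "\<And>u. radial u \<le> r \<Longrightarrow> g u = -1"
    by (rule exit_profile_generator[OF sbm p b r]) blast
  have f0: "0 \<le> f w" if "radial w \<le> r" for w
    using that b c by (simp add: f exit_profile_nonneg)
  have fr: "f w = 0" if "radial w = r" for w
    using that by (simp add: f exit_profile_def)
  show ?thesis
  proof (cases "radial u < r")
    case True
    from mean_exit_time_from_inside[OF fg True f0 fr g] show ?thesis using u by (simp add: f)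
  next
    case False
    then have ur: "radial u = r" using u by simp
    have inner: "AE \<omega> in P u. \<not> (\<exists>d>0. \<forall>q\<in>{0<..d}. radial (X q \<omega>) \<in> {..r} - {r})"
      by (rule no_one_sided_escape[OF fg ur]) (use f0 fr ur g in auto)
    obtain f' g' where fg': "(f', g') \<in> generator (transition_semigroup P X)"
      and f': "\<And>u w. radial u = r \<Longrightarrow> r \<le> radial w \<Longrightarrow> f' u \<le> f' w"
      and g': "\<And>w. r \<le> radial w \<Longrightarrow> g' w < 0"
      by (rule concave_outside_generator[OF sbm p r]) blast
    have outer: "AE \<omega> in P u. \<not> (\<exists>d>0. \<forall>q\<in>{0<..d}. radial (X q \<omega>) \<in> {r..} - {r})"
      by (rule no_one_sided_escape[OF fg' ur]) (use f' ur g' in auto)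
    have "AE \<omega> in P u. exit_time X r \<omega> = 0"
      using inner outer AE_space
    proof eventually_elim
      fix \<omega> assume w: "\<omega> \<in> space (P u)"
        and i: "\<not> (\<exists>d>0. \<forall>q\<in>{0<..d}. radial (X q \<omega>) \<in> {..r} - {r})"
        and o: "\<not> (\<exists>d>0. \<forall>q\<in>{0<..d}. radial (X q \<omega>) \<in> {r..} - {r})"
      have "\<not> 0 < exit_time X r \<omega>"
      proof
        assume "0 < exit_time X r \<omega>"
        then obtain d where "d > 0"
          "(\<forall>q\<in>{0<..d}. radial (X q \<omega>) < r) \<or> (\<forall>q\<in>{0<..d}. r < radial (X q \<omega>))"
          using exit_time_pos_imp_one_side[of X \<omega> r] path_continuous[of \<omega>] w by (auto simp: space_P)
        then show False using i o by force
      qed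
      then show "exit_time X r \<omega> = 0" by simp
    qed
    then have "mean_exit_time P X r u = (\<integral>\<^sup>+\<omega>. 0 \<partial>P u)"
      unfolding mean_exit_time_def by (rule nn_integral_cong_AE)
    then show ?thesis by (simp add: ur exit_profile_def)
  qed
qed

theorem theorem16:
  fixes p :: "'n::finite \<Rightarrow> real" and b c r :: real
    and M :: "'w measure" and P :: "'n star \<Rightarrow> 'w measure" and X :: "real \<Rightarrow> 'w \<Rightarrow> 'n star"
    and v :: "'n star \<Rightarrow> real"
  assumes "\<And>k. 0 \<le> p k \<and> p k \<le> 1" and "(\<Sum>k\<in>UNIV. p k) = 1"
    and "0 < b" and "0 < c" and "b + c = 1"
    and "0 < r"
    and "sticky_brownian_motion p b c M P X"
    and "\<And>u. v u = enn2real (mean_exit_time P X r u)"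
  shows "(\<forall>u. radial u \<le> r \<longrightarrow> mean_exit_time P X r u < \<infinity>) \<and>
    v \<in> A_dom_ball p b c r \<and>
    (\<forall>u. radial u < r \<longrightarrow> 1 / 2 * A_op v u = -1) \<and>
    (\<forall>j. v (pt j r) = 0)"
proof -
  note mean = mean_exit_time_sticky[OF assms(7,2,3,4,6)]
  define \<kappa> where "\<kappa> = c / b"
  define h where "h = exit_profile r \<kappa>"
  define h' where "h' x = - 2 * x - \<kappa>" for x
  have v: "v u = h (radial u)" if "radial u \<le> r" for u
    using that assms(3,4) by (simp add: assms(8) mean h_def \<kappa>_def exit_profile_nonneg)
  have R: "0 < ereal r" using assms(6) by simp
  have v_pt: "v (pt j x) = h x" if "0 < x" "ereal x < ereal r" for j x
    using that by (simp add: v)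
  have d1: "(h has_real_derivative h' x) (at x)" for x
    unfolding h_def exit_profile_def [abs_def] h'_def by (auto intro!: derivative_eq_intros)
  have d2: "(h' has_real_derivative - 2) (at x)" for x
    unfolding h'_def [abs_def] by (auto intro!: derivative_eq_intros)
  have t': "(h' \<longlongrightarrow> - \<kappa>) (at_right 0)"
    unfolding h'_def [abs_def] by (rule tendsto_eq_intros refl | simp)+
  have "continuous_on {u. radial u \<le> r} (\<lambda>u. h (radial u))"
    unfolding h_def exit_profile_def by (intro continuous_intros)
  then have "continuous_on {u. radial u \<le> r} v"
    by (rule continuous_on_eq) (simp add: v)
  moreover have "C2_on_rays (ereal r) v"
    by (rule C2_on_rays_radial[OF R v_pt d1 d2]) auto
  moreover have "vertex_condition p b c v"
    by (rule vertex_condition_radial[OF R v_pt d1 d2 t' tendsto_const assms(2)])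
      (use assms(3) in \<open>auto simp: \<kappa>_def\<close>)
  moreover have "A_op v u = - 2" if "radial u < r" for u
    using A_op_radial[OF R v_pt d1 d2 tendsto_const] that by simp
  moreover have "v (pt j r) = 0" for j
    using assms(6) by (simp add: v h_def exit_profile_def)
  ultimately show ?thesis by (auto simp: A_dom_ball_def mean)
qed

end
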